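(* For every integer $d>2$, the $d$-dimensional hypercube $Q_d$ is not norming.
   Context: $Q_d$ is the graph on $\{0,1\}^d$ in which two vertices are adjacent iff they differ in exactly one coordinate; it is bipartite, with the bipartition given by the parity of the coordinate sum. $\mathcal{F}_{\mathbb{R}}$ is the real vector space of bounded measurable $f:[0,1]^2\to\mathbb{R}$. For a bipartite graph $H$ with bipartition $A\cup B$ and edges $(u,v)$, $u\in A$, $v\in B$, let $t_H(f)=\int\prod_{(u,v)\in E(H)}f(x_u,y_v)$ (variables $x_u,y_v\in[0,1]$, Lebesgue measure). $H$ is norming (= real-norming) if $f\mapsto|t_H(f)|^{1/|E(H)|}$ is a seminorm on $\mathcal{F}_{\mathbb{R}}$ which vanishes only on functions that are $0$ a.e. *)

theory Defs
  imports "HOL-Analysis.Analysis"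
begin

definition unit_square :: "(real \<times> real) set" where
  "unit_square = {0..1} \<times> {0..1}"

text \<open>
  Bounded Lebesgue measurable functions on the unit square. They are represented by total
  functions on the plane; only the values on the square matter, here and in all that follows.
\<close>

definition bounded_measurable :: "(real \<times> real \<Rightarrow> real) set" where
  "bounded_measurable =
     {f. f \<in> borel_measurable (lebesgue_on unit_square) \<and> bounded (f ` unit_square)}"

definition unit_interval_measure :: "real measure" where
  "unit_interval_measure = restrict_space lborel {0..1}"

text \<open>
  A bipartite graph with bipartition \<open>A\<close>, \<open>B\<close> is given by its edges as a set
  \<open>E \<subseteq> A \<times> B\<close> of pairs. The product measure is completed, because for a
  function that is Lebesgue but not Borel measurable the integrand need not be measurable for the
  product sigma-algebra, and then the Bochner integral would be 0 by convention.
\<close>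

definition hom_density ::
  "'a set \<Rightarrow> 'b set \<Rightarrow> ('a \<times> 'b) set \<Rightarrow> (real \<times> real \<Rightarrow> real) \<Rightarrow> real" where
  "hom_density A B E f =
     (\<integral>xy. (\<Prod>(u, v)\<in>E. f (fst xy u, snd xy v))
        \<partial>completion ((\<Pi>\<^sub>M u\<in>A. unit_interval_measure) \<Otimes>\<^sub>M (\<Pi>\<^sub>M v\<in>B. unit_interval_measure)))"

definition seminorm_on :: "('a \<Rightarrow> real) set \<Rightarrow> (('a \<Rightarrow> real) \<Rightarrow> real) \<Rightarrow> bool" where
  "seminorm_on F N \<longleftrightarrow>
     (\<forall>f\<in>F. 0 \<le> N f) \<and>
     (\<forall>f\<in>F. \<forall>c. N (\<lambda>z. c * f z) = \<bar>c\<bar> * N f) \<and>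
     (\<forall>f\<in>F. \<forall>g\<in>F. N (\<lambda>z. f z + g z) \<le> N f + N g)"

definition graph_norm ::
  "'a set \<Rightarrow> 'b set \<Rightarrow> ('a \<times> 'b) set \<Rightarrow> (real \<times> real \<Rightarrow> real) \<Rightarrow> real" where
  "graph_norm A B E f = \<bar>hom_density A B E f\<bar> powr (1 / real (card E))"

definition norming :: "'a set \<Rightarrow> 'b set \<Rightarrow> ('a \<times> 'b) set \<Rightarrow> bool" where
  "norming A B E \<longleftrightarrow>
     seminorm_on bounded_measurable (graph_norm A B E) \<and>
     (\<forall>f\<in>bounded_measurable. graph_norm A B E f = 0 \<longrightarrow>
        (AE z in lebesgue_on unit_square. f z = 0))"

definition cube_verts :: "nat \<Rightarrow> (nat \<Rightarrow> nat) set" where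
  "cube_verts d = {..<d} \<rightarrow>\<^sub>E {0, 1}"

definition cube_adj :: "nat \<Rightarrow> (nat \<Rightarrow> nat) \<Rightarrow> (nat \<Rightarrow> nat) \<Rightarrow> bool" where
  "cube_adj d u v \<longleftrightarrow>
     u \<in> cube_verts d \<and> v \<in> cube_verts d \<and> card {i. i < d \<and> u i \<noteq> v i} = 1"

definition cube_even :: "nat \<Rightarrow> (nat \<Rightarrow> nat) set" where
  "cube_even d = {u \<in> cube_verts d. even (\<Sum>i<d. u i)}"

definition cube_odd :: "nat \<Rightarrow> (nat \<Rightarrow> nat) set" where
  "cube_odd d = {u \<in> cube_verts d. odd (\<Sum>i<d. u i)}"

text \<open>Each edge is listed once, with its even endpoint first.\<close>

definition cube_edges :: "nat \<Rightarrow> ((nat \<Rightarrow> nat) \<times> (nat \<Rightarrow> nat)) set" where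
  "cube_edges d = {(u, v). u \<in> cube_even d \<and> v \<in> cube_odd d \<and> cube_adj d u v}"

lemma cube_verts_partition:
  "cube_verts d = cube_even d \<union> cube_odd d" "cube_even d \<inter> cube_odd d = {}"
  by (auto simp: cube_even_def cube_odd_def)

lemma finite_cube_verts: "finite (cube_verts d)"
  by (simp add: cube_verts_def finite_PiE)

lemma cube_adj_sym: "cube_adj d u v \<longleftrightarrow> cube_adj d v u"
proof -
  have "{i. i < d \<and> u i \<noteq> v i} = {i. i < d \<and> v i \<noteq> u i}" by auto
  then show ?thesis by (auto simp: cube_adj_def)
qed

lemma cube_adj_bipartite:
  assumes "cube_adj d u v"
  shows "u \<in> cube_even d \<longleftrightarrow> v \<in> cube_odd d"
proof -
  have u: "u \<in> cube_verts d" and v: "v \<in> cube_verts d"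
    using assms by (auto simp: cube_adj_def)
  obtain j where j: "{i. i < d \<and> u i \<noteq> v i} = {j}"
    using assms by (auto simp: cube_adj_def card_1_singleton_iff)
  then have jd: "j < d" "u j \<noteq> v j" by auto
  have eq: "(\<Sum>i\<in>{..<d} - {j}. u i) = (\<Sum>i\<in>{..<d} - {j}. v i)"
    using j by (intro sum.cong) auto
  have "u j \<in> {0, 1}" "v j \<in> {0, 1}"
    using u v jd(1) by (auto simp: cube_verts_def PiE_iff)
  then have "odd (u j + v j)" using jd(2) by auto
  moreover have "(\<Sum>i<d. u i) = u j + (\<Sum>i\<in>{..<d} - {j}. u i)"
    "(\<Sum>i<d. v i) = v j + (\<Sum>i\<in>{..<d} - {j}. v i)"
    using jd(1) by (auto intro: sum.remove)
  ultimately show ?thesis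
    using u v eq by (auto simp: cube_even_def cube_odd_def)
qed

lemma cube_adj_iff_edges:
  "cube_adj d u v \<longleftrightarrow> (u, v) \<in> cube_edges d \<or> (v, u) \<in> cube_edges d"
proof
  assume *: "cube_adj d u v"
  then have "cube_adj d v u" by (simp add: cube_adj_sym)
  moreover have "u \<in> cube_even d \<or> u \<in> cube_odd d"
    using * cube_verts_partition(1)[of d] by (auto simp: cube_adj_def)
  ultimately show "(u, v) \<in> cube_edges d \<or> (v, u) \<in> cube_edges d"
    using * cube_adj_bipartite[of d u v] cube_adj_bipartite[of d v u]
    by (auto simp: cube_edges_def)
qed (auto simp: cube_edges_def cube_adj_sym)

end

theory Submission
  imports Defs
begin

text \<open>
  If \<open>d\<close> is odd, \<open>f(x, y) = \<plusminus>1\<close> given by a sign of \<open>x\<close> times a sign of \<open>y\<close> has density 0. So let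
  \<open>d = 2h\<close>. On step functions the density becomes a sum over maps of the two vertex classes into a
  finite set, and for a complex matrix \<open>F\<close> the sum of \<open>Re F\<close> is, up to a constant, the sum over all
  edge colourings \<open>P \<subseteq> E\<close> of \<open>t\<^sub>P(F)\<close>, in which the factors of the edges outside \<open>P\<close> are conjugated.
  Each \<open>t\<^sub>P\<close> is multiplicative under tensor products, which gives two ways to select colourings.
  Tensoring with the character matrix \<open>\<omega>\<^bsup>x + y\<^esup>\<close> kills every \<open>P\<close> that is not balanced at each vertex.
  Tensoring with a high power of \<open>1 + \<epsilon> \<omega>\<^bsup>x + y\<^esup>\<close> selects the \<open>P\<close> that maximise the number of
  alternating 4-cycles, because \<open>t\<^sub>P(1 + \<epsilon> \<omega>\<^bsup>x + y\<^esup>) \<approx> 1 + \<epsilon>\<^sup>4 (number of alternating 4-cycles)\<close>. In a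
  maximiser every 4-cycle is alternating or monochromatic, so for \<open>F\<^sub>z = 1 + \<epsilon> z (-1)\<^bsup>x + y\<^esup>\<close> the
  \<open>\<epsilon>\<^sup>4\<close>-coefficient of \<open>Re t\<^sub>P(F\<^sub>z)\<close> is a positive multiple of
  \<open>h \<bar>z\<bar>\<^sup>4 + (h - 1) Re z\<^sup>4\<close>. As \<open>F\<^bsub>Re z\<^esub>\<close> is the average of \<open>F\<^sub>z\<close> and \<open>F\<^bsub>cnj z\<^esub>\<close>, a norm would force
  this coefficient not to increase when \<open>z\<close> is replaced by \<open>Re z\<close>, which fails for \<open>z = (4 + 3i)/5\<close>.
\<close>

section \<open>Coloured homomorphism sums\<close>

definition cj :: "bool \<Rightarrow> complex \<Rightarrow> complex" where
  "cj b z = (if b then z else cnj z)"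

lemma cj_mult: "cj b (w * z) = cj b w * cj b z"
  by (simp add: cj_def)

text \<open>The quantity t_P(F) of the overview, without normalisation. The index set
  \<open>I\<close> is a parameter of arbitrary type, so that the tensor product of a matrix over
  \<open>I\<close> with one over \<open>J\<close> is a matrix over
  \<open>I \<times> J\<close>.\<close>

definition colour_sum ::
  "'a set \<Rightarrow> 'b set \<Rightarrow> ('a \<times> 'b) set \<Rightarrow> 'i set \<Rightarrow> ('a \<times> 'b) set \<Rightarrow> ('i \<Rightarrow> 'i \<Rightarrow> complex) \<Rightarrow> complex" where
  "colour_sum A B E I P F =
     (\<Sum>\<phi>\<in>A \<rightarrow>\<^sub>E I. \<Sum>\<psi>\<in>B \<rightarrow>\<^sub>E I. \<Prod>e\<in>E. cj (e \<in> P) (F (\<phi> (fst e)) (\<psi> (snd e))))"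

definition hom_sum ::
  "'a set \<Rightarrow> 'b set \<Rightarrow> ('a \<times> 'b) set \<Rightarrow> 'i set \<Rightarrow> ('i \<Rightarrow> 'i \<Rightarrow> real) \<Rightarrow> real" where
  "hom_sum A B E I W =
     (\<Sum>\<phi>\<in>A \<rightarrow>\<^sub>E I. \<Sum>\<psi>\<in>B \<rightarrow>\<^sub>E I. \<Prod>e\<in>E. W (\<phi> (fst e)) (\<psi> (snd e)))"

lemma hom_sum_cmult:
  "hom_sum A B E I (\<lambda>x y. c * W x y) = c ^ card E * hom_sum A B E I W"
  by (simp add: hom_sum_def prod.distrib sum_distrib_left)

lemma cj_one [simp]: "cj b 1 = 1"
  by (simp add: cj_def)

lemma cj_of_real [simp]: "cj b (of_real x) = of_real x"
  by (simp add: cj_def)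

lemma colour_sum_of_real:
  "colour_sum A B E I P (\<lambda>x y. of_real (W x y)) = of_real (hom_sum A B E I W)"
  by (simp add: colour_sum_def hom_sum_def)

text \<open>Each factor is \<open>Re w = (w + cnj w) / 2\<close>. When the product over the edges is
  multiplied out, \<open>P\<close> records the edges at which \<open>w\<close> rather than
  \<open>cnj w\<close> was chosen.\<close>

lemma hom_sum_Re:
  assumes "finite E"
  shows "of_real (hom_sum A B E I (\<lambda>x y. Re (F x y)))
    = (1 / 2) ^ card E * (\<Sum>P\<in>Pow E. colour_sum A B E I P F)"
proof -
  have prod_Re: "of_real (\<Prod>e\<in>E. Re (g e)) = (1 / 2) ^ card E * (\<Sum>P\<in>Pow E. \<Prod>e\<in>E. cj (e \<in> P) (g e))"
    for g :: "_ \<Rightarrow> complex"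
  proof -
    have "of_real (\<Prod>e\<in>E. Re (g e)) = (\<Prod>e\<in>E. (1 / 2) * (g e + cnj (g e)))"
      by (simp add: complex_add_cnj)
    also have "\<dots> = (1 / 2) ^ card E * (\<Prod>e\<in>E. g e + cnj (g e))"
      by (simp only: prod.distrib prod_constant)
    also have "(\<Prod>e\<in>E. g e + cnj (g e)) = (\<Sum>P\<in>Pow E. (\<Prod>e\<in>P. g e) * (\<Prod>e\<in>E - P. cnj (g e)))"
      by (rule prod_add[OF assms])
    also have "\<dots> = (\<Sum>P\<in>Pow E. \<Prod>e\<in>E. cj (e \<in> P) (g e))"
    proof (rule sum.cong[OF refl])
      fix P assume "P \<in> Pow E"
      then have "(\<Prod>e\<in>E. cj (e \<in> P) (g e)) = (\<Prod>e\<in>E - P. cj (e \<in> P) (g e)) * (\<Prod>e\<in>P. cj (e \<in> P) (g e))"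
        using assms by (intro prod.subset_diff) auto
      also have "\<dots> = (\<Prod>e\<in>P. g e) * (\<Prod>e\<in>E - P. cnj (g e))"
        by (simp add: cj_def mult.commute)
      finally show "(\<Prod>e\<in>P. g e) * (\<Prod>e\<in>E - P. cnj (g e)) = (\<Prod>e\<in>E. cj (e \<in> P) (g e))" ..
    qed
    finally show ?thesis .
  qed
  have "of_real (hom_sum A B E I (\<lambda>x y. Re (F x y)))
      = (\<Sum>\<phi>\<in>A \<rightarrow>\<^sub>E I. \<Sum>\<psi>\<in>B \<rightarrow>\<^sub>E I. (1 / 2) ^ card E *
          (\<Sum>P\<in>Pow E. \<Prod>e\<in>E. cj (e \<in> P) (F (\<phi> (fst e)) (\<psi> (snd e)))))"
    unfolding hom_sum_def of_real_sum prod_Re ..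
  also have "\<dots> = (1 / 2) ^ card E * (\<Sum>\<phi>\<in>A \<rightarrow>\<^sub>E I. \<Sum>\<psi>\<in>B \<rightarrow>\<^sub>E I.
          \<Sum>P\<in>Pow E. \<Prod>e\<in>E. cj (e \<in> P) (F (\<phi> (fst e)) (\<psi> (snd e))))"
    by (simp only: sum_distrib_left)
  also have "(\<Sum>\<phi>\<in>A \<rightarrow>\<^sub>E I. \<Sum>\<psi>\<in>B \<rightarrow>\<^sub>E I.
          \<Sum>P\<in>Pow E. \<Prod>e\<in>E. cj (e \<in> P) (F (\<phi> (fst e)) (\<psi> (snd e))))
     = (\<Sum>P\<in>Pow E. colour_sum A B E I P F)"
    unfolding colour_sum_def by (subst sum.swap[of _ "Pow E"], subst sum.swap[of _ "Pow E"]) (rule refl)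
  finally show ?thesis .
qed

section \<open>Tensor products and relabelling\<close>

lemma sum_PiE_Times:
  "(\<Sum>\<phi>\<in>A \<rightarrow>\<^sub>E I \<times> J. f (\<lambda>a\<in>A. fst (\<phi> a)) (\<lambda>a\<in>A. snd (\<phi> a)))
    = (\<Sum>\<phi>\<in>A \<rightarrow>\<^sub>E I. \<Sum>\<psi>\<in>A \<rightarrow>\<^sub>E J. f \<phi> \<psi>)"
  unfolding sum.cartesian_product
  by (rule sum.reindex_bij_witness[where
        i = "\<lambda>(\<phi>, \<psi>). \<lambda>a\<in>A. (\<phi> a, \<psi> a)" and j = "\<lambda>\<phi>. (\<lambda>a\<in>A. fst (\<phi> a), \<lambda>a\<in>A. snd (\<phi> a))"])
    (auto simp: PiE_iff fun_eq_iff extensional_def restrict_def mem_Times_iff)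

lemma sum_PiE_bij_betw:
  assumes "bij_betw h I J"
  shows "(\<Sum>\<phi>\<in>A \<rightarrow>\<^sub>E I. f (\<lambda>a\<in>A. h (\<phi> a))) = (\<Sum>\<phi>\<in>A \<rightarrow>\<^sub>E J. f \<phi>)"
  using bij_betwE[OF assms] bij_betwE[OF bij_betw_inv_into[OF assms]]
    bij_betw_inv_into_left[OF assms] bij_betw_inv_into_right[OF assms]
  by (intro sum.reindex_bij_witness[where
        i = "\<lambda>\<phi>. \<lambda>a\<in>A. inv_into I h (\<phi> a)" and j = "\<lambda>\<phi>. \<lambda>a\<in>A. h (\<phi> a)"])
    (auto simp: PiE_iff fun_eq_iff extensional_def restrict_def)

text \<open>A map into \<open>I \<times> J\<close> is a pair of maps, and conjugation is
  multiplicative, so the product over the edges splits and then the sums separate.\<close>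

lemma colour_sum_tensor:
  assumes "E \<subseteq> A \<times> B"
  shows "colour_sum A B E (I \<times> J) P (\<lambda>x y. F (fst x) (fst y) * G (snd x) (snd y))
    = colour_sum A B E I P F * colour_sum A B E J P G"
proof -
  let ?g = "\<lambda>\<phi> \<psi> \<phi>' \<psi>'. (\<Prod>e\<in>E. cj (e \<in> P) (F (\<phi> (fst e)) (\<psi> (snd e))))
     * (\<Prod>e\<in>E. cj (e \<in> P) (G (\<phi>' (fst e)) (\<psi>' (snd e))))"
  have "colour_sum A B E (I \<times> J) P (\<lambda>x y. F (fst x) (fst y) * G (snd x) (snd y))
     = (\<Sum>\<phi>\<in>A \<rightarrow>\<^sub>E I \<times> J. \<Sum>\<psi>\<in>B \<rightarrow>\<^sub>E I \<times> J.
         ?g (\<lambda>a\<in>A. fst (\<phi> a)) (\<lambda>a\<in>B. fst (\<psi> a)) (\<lambda>a\<in>A. snd (\<phi> a)) (\<lambda>a\<in>B. snd (\<psi> a)))"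
    unfolding colour_sum_def prod.distrib[symmetric] using assms
    by (intro sum.cong prod.cong refl) (auto simp: cj_mult)
  also have "\<dots> = (\<Sum>\<phi>\<in>A \<rightarrow>\<^sub>E I. \<Sum>\<phi>'\<in>A \<rightarrow>\<^sub>E J. \<Sum>\<psi>\<in>B \<rightarrow>\<^sub>E I. \<Sum>\<psi>'\<in>B \<rightarrow>\<^sub>E J. ?g \<phi> \<psi> \<phi>' \<psi>')"
    unfolding sum_PiE_Times[where A = B and f = "\<lambda>\<psi> \<psi>'. ?g x \<psi> y \<psi>'" for x y]
    by (rule sum_PiE_Times[of "\<lambda>\<phi> \<phi>'. \<Sum>\<psi>\<in>B \<rightarrow>\<^sub>E I. \<Sum>\<psi>'\<in>B \<rightarrow>\<^sub>E J. ?g \<phi> \<psi> \<phi>' \<psi>'" A I J])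
  also have "\<dots> = colour_sum A B E I P F * colour_sum A B E J P G"
    unfolding colour_sum_def by (simp only: sum_product)
  finally show ?thesis .
qed

lemma colour_sum_bij_betw:
  assumes "E \<subseteq> A \<times> B" and h: "bij_betw h I J"
  shows "colour_sum A B E I P (\<lambda>x y. F (h x) (h y)) = colour_sum A B E J P F"
proof -
  have "colour_sum A B E I P (\<lambda>x y. F (h x) (h y))
      = (\<Sum>\<phi>\<in>A \<rightarrow>\<^sub>E I. \<Sum>\<psi>\<in>B \<rightarrow>\<^sub>E I.
          \<Prod>e\<in>E. cj (e \<in> P) (F ((\<lambda>a\<in>A. h (\<phi> a)) (fst e)) ((\<lambda>b\<in>B. h (\<psi> b)) (snd e))))"
    unfolding colour_sum_def using assms(1) by (intro sum.cong prod.cong refl) auto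
  also have "\<dots> = colour_sum A B E J P F"
    unfolding colour_sum_def
      sum_PiE_bij_betw[OF h, where A = B and f = "\<lambda>\<psi>. \<Prod>e\<in>E. cj (e \<in> P) (F (x (fst e)) (\<psi> (snd e)))" for x]
    by (rule sum_PiE_bij_betw[OF h, of "\<lambda>\<phi>. \<Sum>\<psi>\<in>B \<rightarrow>\<^sub>E J. \<Prod>e\<in>E. cj (e \<in> P) (F (\<phi> (fst e)) (\<psi> (snd e)))"])
  finally show ?thesis .
qed

lemma hom_sum_bij_betw:
  assumes "E \<subseteq> A \<times> B" "bij_betw h I J"
  shows "hom_sum A B E I (\<lambda>x y. W (h x) (h y)) = hom_sum A B E J W"
  using colour_sum_bij_betw[OF assms, of E "\<lambda>x y. of_real (W x y)"]
  by (simp add: colour_sum_of_real)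

lemma PiE_lessThan_one: "(A \<rightarrow>\<^sub>E {..<Suc 0}) = {\<lambda>a\<in>A. 0}"
  by (auto simp: PiE_iff extensional_def fun_eq_iff)

text \<open>The \<open>k\<close>-fold tensor power. After each factor the index set is relabelled by
  naturals, because the type of an iterated product would vary with \<open>k\<close>. One matrix
  \<open>G\<close> serves all colourings \<open>P\<close> at once, which is what lets the colourings
  be weighted against each other.\<close>

lemma colour_sum_power:
  fixes F :: "nat \<Rightarrow> nat \<Rightarrow> complex"
  assumes E: "E \<subseteq> A \<times> B" and n: "n > 0"
  shows "\<exists>m>0. \<exists>G :: nat \<Rightarrow> nat \<Rightarrow> complex. \<forall>P.
     colour_sum A B E {..<m} P G = colour_sum A B E {..<n} P F ^ k"
proof (induction k)
  case 0
  have "colour_sum A B E {..<1} P (\<lambda>(_::nat) _. 1) = 1" for P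
    unfolding colour_sum_def by (simp add: PiE_lessThan_one)
  then show ?case
    by (intro exI[of _ 1] conjI exI[of _ "\<lambda>_ _. 1"]) auto
next
  case (Suc k)
  then obtain m and G :: "nat \<Rightarrow> nat \<Rightarrow> complex" where m: "m > 0"
    and G: "\<And>P. colour_sum A B E {..<m} P G = colour_sum A B E {..<n} P F ^ k" by blast
  obtain h where h: "bij_betw h {..<n * m} ({..<n} \<times> {..<m})"
    using ex_bij_betw_nat_finite[of "{..<n} \<times> {..<m}"]
    by (auto simp: card_cartesian_product lessThan_atLeast0)
  let ?T = "\<lambda>x y. F (fst x) (fst y) * G (snd x) (snd y)"
  have "colour_sum A B E {..<n * m} P (\<lambda>x y. ?T (h x) (h y)) = colour_sum A B E {..<n} P F ^ Suc k" for P
    unfolding colour_sum_bij_betw[OF E h, of P ?T] by (simp add: colour_sum_tensor[OF E] G)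
  then show ?case using n m
    by (intro exI[of _ "n * m"] conjI exI[of _ "\<lambda>x y. ?T (h x) (h y)"]) auto
qed

section \<open>Roots of unity and balanced edge sets\<close>

definition sg :: "bool \<Rightarrow> int" where
  "sg b = (if b then 1 else -1)"

text \<open>The condition under which the character sums over both vertex classes survive: at each
  vertex the edges of \<open>K\<close> inside \<open>P\<close> and those outside \<open>P\<close>
  are equally many modulo \<open>m\<close>. For \<open>m = 2\<close> it says that all degrees of
  \<open>K\<close> are even, whatever \<open>P\<close> is; once \<open>m\<close> exceeds the degrees
  it means equality.\<close>

definition balanced ::
  "'a set \<Rightarrow> 'b set \<Rightarrow> nat \<Rightarrow> ('a \<times> 'b) set \<Rightarrow> ('a \<times> 'b) set \<Rightarrow> bool" where
  "balanced A B m P K \<longleftrightarrow>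
     (\<forall>u\<in>A. int m dvd (\<Sum>e\<in>{e\<in>K. fst e = u}. sg (e \<in> P))) \<and>
     (\<forall>v\<in>B. int m dvd (\<Sum>e\<in>{e\<in>K. snd e = v}. sg (e \<in> P)))"

text \<open>The summands are the powers of an \<open>m\<close>-th root of unity \<open>w\<close>, so
  the geometric series gives 0 unless \<open>w = 1\<close>, and \<open>w = 1\<close> is the
  divisibility condition.\<close>

lemma sum_roots_unity:
  assumes "m > 0"
  shows "(\<Sum>i<m. cis (2 * pi * real i * of_int s / real m)) = (if int m dvd s then of_nat m else 0)"
proof -
  define w where "w = cis (2 * pi * of_int s / real m)"
  have pow: "cis (2 * pi * real i * of_int s / real m) = w ^ i" for i
  proof -
    have "2 * pi * real i * of_int s / real m = real i * (2 * pi * of_int s / real m)" by simp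
    then show ?thesis by (simp only: w_def Complex.DeMoivre)
  qed
  have w1: "w = 1 \<longleftrightarrow> int m dvd s"
  proof
    assume "w = 1"
    then have "cos (2 * pi * of_int s / real m) = 1"
      by (simp add: w_def complex_eq_iff)
    then obtain k :: int where "2 * pi * of_int s / real m = of_int k * 2 * pi"
      by (auto simp: cos_one_2pi_int)
    then have "of_int s = (of_int (k * int m) :: real)"
      using assms by (simp add: field_simps)
    then have "s = k * int m" by (simp only: of_int_eq_iff)
    then show "int m dvd s" by simp
  next
    assume "int m dvd s"
    then obtain k where "s = int m * k" by (auto elim: dvdE)
    then have "2 * pi * of_int s / real m = 2 * pi * of_int k" using assms by simp
    then have "w = cis (2 * pi * of_int k)" by (simp only: w_def)
    also have "\<dots> = 1" by (rule cis_multiple_2pi) simp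
    finally show "w = 1" .
  qed
  have wm: "w ^ m = 1"
  proof -
    have "w ^ m = cis (real m * (2 * pi * of_int s / real m))"
      by (simp only: w_def Complex.DeMoivre)
    also have "\<dots> = cis (2 * pi * of_int s)" using assms by simp
    also have "\<dots> = 1" by (rule cis_multiple_2pi) simp
    finally show ?thesis .
  qed
  show ?thesis
  proof (cases "int m dvd s")
    case True
    then show ?thesis using w1 by (simp add: pow)
  next
    case False
    then have "w \<noteq> 1" using w1 by simp
    then show ?thesis using False wm by (simp add: pow geometric_sum)
  qed
qed

text \<open>Here \<open>g\<close> sends an edge to its end in one vertex class. Collecting the edges
  at each vertex turns the sum over all maps into a product of one-vertex character sums, each of
  which is \<open>m\<close> or 0.\<close>

lemma sum_PiE_character:
  fixes g :: "'e \<Rightarrow> 'a" and s :: "'e \<Rightarrow> int"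
  assumes "finite A" "finite K" "g ` K \<subseteq> A" "m > 0"
  shows "(\<Sum>\<phi>\<in>A \<rightarrow>\<^sub>E {..<m}. \<Prod>e\<in>K. cis (2 * pi * real (\<phi> (g e)) * of_int (s e) / real m))
    = (if \<forall>u\<in>A. int m dvd (\<Sum>e\<in>{e\<in>K. g e = u}. s e) then of_nat m ^ card A else 0)"
proof -
  have "(\<Prod>e\<in>K. cis (2 * pi * real (\<phi> (g e)) * of_int (s e) / real m))
      = (\<Prod>u\<in>A. cis (2 * pi * real (\<phi> u) * of_int (\<Sum>e\<in>{e\<in>K. g e = u}. s e) / real m))" for \<phi> :: "'a \<Rightarrow> nat"
  proof -
    have "(\<Prod>e\<in>K. cis (2 * pi * real (\<phi> (g e)) * of_int (s e) / real m))
       = (\<Prod>u\<in>A. \<Prod>e\<in>{e\<in>K. g e = u}. cis (2 * pi * real (\<phi> (g e)) * of_int (s e) / real m))"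
      by (rule prod.group[symmetric]) (use assms in auto)
    also have "\<dots> = (\<Prod>u\<in>A. cis (\<Sum>e\<in>{e\<in>K. g e = u}. 2 * pi * real (\<phi> u) * of_int (s e) / real m))"
      by (intro prod.cong refl) (simp add: cis_conv_exp exp_sum[symmetric] sum_distrib_left assms(2))
    also have "\<dots> = (\<Prod>u\<in>A. cis (2 * pi * real (\<phi> u) * of_int (\<Sum>e\<in>{e\<in>K. g e = u}. s e) / real m))"
      by (simp add: sum_distrib_left sum_divide_distrib)
    finally show ?thesis .
  qed
  then have "(\<Sum>\<phi>\<in>A \<rightarrow>\<^sub>E {..<m}. \<Prod>e\<in>K. cis (2 * pi * real (\<phi> (g e)) * of_int (s e) / real m))
     = (\<Prod>u\<in>A. \<Sum>i<m. cis (2 * pi * real i * of_int (\<Sum>e\<in>{e\<in>K. g e = u}. s e) / real m))"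
    by (simp only: prod_sum_PiE[OF assms(1) finite_lessThan])
  also have "\<dots> = (\<Prod>u\<in>A. if int m dvd (\<Sum>e\<in>{e\<in>K. g e = u}. s e) then of_nat m else 0)"
    by (simp only: sum_roots_unity[OF assms(4)])
  also have "\<dots> = (if \<forall>u\<in>A. int m dvd (\<Sum>e\<in>{e\<in>K. g e = u}. s e) then of_nat m ^ card A else 0)"
    using assms(1) by (auto simp: prod_zero_iff)
  finally show ?thesis .
qed

text \<open>The character is taken at \<open>x + y\<close> so that it splits into one factor for
  each end of an edge. The case \<open>c = 0\<close> serves as a filter on colourings, the case
  \<open>c = 1\<close> with small \<open>z\<close> as a perturbation of the constant
  function.\<close>

definition char_matrix :: "nat \<Rightarrow> real \<Rightarrow> complex \<Rightarrow> nat \<Rightarrow> nat \<Rightarrow> complex" where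
  "char_matrix m c z x y = of_real c + z * cis (2 * pi * real (x + y) / real m)"

text \<open>Multiplying out, \<open>K\<close> is the set of edges at which the character term is
  chosen. Summing over the two vertex maps then kills every \<open>K\<close> that is not
  balanced.\<close>

lemma colour_sum_char_matrix:
  assumes fin: "finite A" "finite B" and E: "E \<subseteq> A \<times> B" and m: "m > 0"
  shows "colour_sum A B E {..<m} P (char_matrix m c z)
    = of_nat m ^ (card A + card B) *
      (\<Sum>K\<in>{K\<in>Pow E. balanced A B m P K}. of_real c ^ card (E - K) * (\<Prod>e\<in>K. cj (e \<in> P) z))"
proof -
  have finE: "finite E" using fin E by (meson finite_SigmaI finite_subset)
  define \<theta> where "\<theta> x s = cis (2 * pi * real x * of_int s / real m)" for x :: nat and s
  \<comment> \<open>Conjugation inverts a root of unity, so an edge outside \<open>P\<close>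
    contributes its exponent with sign -1; this is the origin of \<open>sg\<close>.\<close>
  have entry: "cj b (char_matrix m c z x y) = cj b z * (\<theta> x (sg b) * \<theta> y (sg b)) + of_real c" for b x y
    by (auto simp: cj_def char_matrix_def \<theta>_def sg_def cis_mult cis_cnj add_divide_distrib algebra_simps)
  have expand: "(\<Prod>e\<in>E. cj (e \<in> P) (char_matrix m c z (\<phi> (fst e)) (\<psi> (snd e))))
     = (\<Sum>K\<in>Pow E. (of_real c ^ card (E - K) * (\<Prod>e\<in>K. cj (e \<in> P) z)) *
         ((\<Prod>e\<in>K. \<theta> (\<phi> (fst e)) (sg (e \<in> P))) * (\<Prod>e\<in>K. \<theta> (\<psi> (snd e)) (sg (e \<in> P)))))" for \<phi> \<psi>
    unfolding entry prod_add[OF finE] by (intro sum.cong refl) (simp add: prod.distrib mult_ac)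
  have "colour_sum A B E {..<m} P (char_matrix m c z)
     = (\<Sum>K\<in>Pow E. of_real c ^ card (E - K) * (\<Prod>e\<in>K. cj (e \<in> P) z) *
         ((\<Sum>\<phi>\<in>A \<rightarrow>\<^sub>E {..<m}. \<Prod>e\<in>K. \<theta> (\<phi> (fst e)) (sg (e \<in> P))) *
          (\<Sum>\<psi>\<in>B \<rightarrow>\<^sub>E {..<m}. \<Prod>e\<in>K. \<theta> (\<psi> (snd e)) (sg (e \<in> P)))))"
    unfolding colour_sum_def expand sum_product
    by (subst sum.swap[of _ "Pow E"], subst sum.swap[of _ "Pow E"]) (simp only: sum_distrib_left)
  also have "\<dots> = (\<Sum>K\<in>Pow E. if balanced A B m P K
      then of_nat m ^ (card A + card B) * (of_real c ^ card (E - K) * (\<Prod>e\<in>K. cj (e \<in> P) z)) else 0)"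
  proof (rule sum.cong[OF refl])
    fix K assume "K \<in> Pow E"
    then have K: "finite K" "fst ` K \<subseteq> A" "snd ` K \<subseteq> B"
      using finE E finite_subset by auto
    show "of_real c ^ card (E - K) * (\<Prod>e\<in>K. cj (e \<in> P) z) *
         ((\<Sum>\<phi>\<in>A \<rightarrow>\<^sub>E {..<m}. \<Prod>e\<in>K. \<theta> (\<phi> (fst e)) (sg (e \<in> P))) *
          (\<Sum>\<psi>\<in>B \<rightarrow>\<^sub>E {..<m}. \<Prod>e\<in>K. \<theta> (\<psi> (snd e)) (sg (e \<in> P))))
      = (if balanced A B m P K
      then of_nat m ^ (card A + card B) * (of_real c ^ card (E - K) * (\<Prod>e\<in>K. cj (e \<in> P) z)) else 0)"
      unfolding \<theta>_def sum_PiE_character[OF fin(1) K(1) K(2) m] sum_PiE_character[OF fin(2) K(1) K(3) m]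
        balanced_def by (auto simp: power_add)
  qed
  also have "\<dots> = of_nat m ^ (card A + card B) *
      (\<Sum>K\<in>{K\<in>Pow E. balanced A B m P K}. of_real c ^ card (E - K) * (\<Prod>e\<in>K. cj (e \<in> P) z))"
    using finE by (subst sum.inter_filter[symmetric]) (auto simp: sum_distrib_left)
  finally show ?thesis .
qed

section \<open>Densities of step functions\<close>

lemma equal_partition_unit_interval:
  assumes "n > 0"
  shows "\<exists>idx :: real \<Rightarrow> nat. idx \<in> borel \<rightarrow>\<^sub>M count_space UNIV \<and> (\<forall>x. idx x < n) \<and>
    (\<forall>i<n. emeasure unit_interval_measure {x\<in>{0..1}. idx x = i} = ennreal (1 / real n))"
proof (intro exI conjI allI impI)
  \<comment> \<open>The minimum puts the point 1 into the last cell, which is therefore closed.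
    Negative arguments go to cell 0, so the index is below \<open>n\<close> on the whole
    line.\<close>
  let ?idx = "\<lambda>x::real. min (n - 1) (nat \<lfloor>real n * x\<rfloor>)"
  show "?idx \<in> borel \<rightarrow>\<^sub>M count_space UNIV" by measurable
  show "?idx x < n" for x using assms by (simp add: min_def) linarith
  fix i assume i: "i < n"
  have "emeasure lborel {x\<in>{0..1}. ?idx x = i} = ennreal (1 / real n)"
  proof (cases "i = n - 1")
    case True
    have "{x\<in>{0..1}. ?idx x = i} = {real i / real n .. 1}"
    proof (intro set_eqI iffI)
      fix x :: real assume "x \<in> {x\<in>{0..1}. ?idx x = i}"
      then have x: "0 \<le> x" "x \<le> 1" "i \<le> nat \<lfloor>real n * x\<rfloor>" using True by auto
      then have "real i \<le> real n * x" by (simp add: le_nat_floor le_nat_iff le_floor_iff)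
      then show "x \<in> {real i / real n .. 1}" using x assms by (simp add: field_simps)
    next
      fix x :: real assume x: "x \<in> {real i / real n .. 1}"
      then have "real i \<le> real n * x" using assms by (auto simp: field_simps)
      moreover have "0 \<le> x" using x by (auto intro: order_trans[rotated])
      ultimately have "real i \<le> real n * x" "0 \<le> x" .
      then show "x \<in> {x\<in>{0..1}. ?idx x = i}" using x True
        by (auto simp: le_nat_floor)
    qed
    then show ?thesis using i True by (simp add: field_simps of_nat_diff)
  next
    case False
    have "{x\<in>{0..1}. ?idx x = i} = {real i / real n ..< real (Suc i) / real n}"
    proof (intro set_eqI iffI)
      fix x :: real assume "x \<in> {x\<in>{0..1}. ?idx x = i}"
      then have x: "0 \<le> x" "x \<le> 1" "nat \<lfloor>real n * x\<rfloor> = i" using False i by (auto simp: min_def split: if_splits)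
      then have "\<lfloor>real n * x\<rfloor> = int i" using assms by auto
      then have "real i \<le> real n * x" "real n * x < real i + 1" by linarith+
      then show "x \<in> {real i / real n ..< real (Suc i) / real n}" using x assms by (simp add: field_simps)
    next
      fix x :: real assume x: "x \<in> {real i / real n ..< real (Suc i) / real n}"
      then have *: "real i \<le> real n * x" "real n * x < real i + 1" using assms
        by (auto simp: field_simps)
      then have "\<lfloor>real n * x\<rfloor> = int i" by linarith
      moreover have "0 \<le> x" using x by (auto intro: order_trans[rotated])
      moreover have "real i + 1 \<le> real n" using i by linarith
      then have "real n * x \<le> real n" using * by linarith
      then have "x \<le> 1" using assms by simp
      ultimately show "x \<in> {x\<in>{0..1}. ?idx x = i}" using i by simp
    qed
    moreover have "real (Suc i) / real n - real i / real n = 1 / real n"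
      by (simp add: diff_divide_distrib[symmetric])
    ultimately show ?thesis using assms by (simp add: divide_right_mono)
  qed
  then show "emeasure unit_interval_measure {x\<in>{0..1}. ?idx x = i} = ennreal (1 / real n)"
    unfolding unit_interval_measure_def by (subst emeasure_restrict_space) auto
qed

lemma space_unit_interval_measure [simp]: "space unit_interval_measure = {0..1}"
  by (simp add: unit_interval_measure_def space_restrict_space)

lemma sigma_finite_unit_interval_measure: "sigma_finite_measure unit_interval_measure"
proof -
  have "emeasure unit_interval_measure {0..1} = 1"
    unfolding unit_interval_measure_def by (subst emeasure_restrict_space) auto
  then have "finite_measure unit_interval_measure" by (intro finite_measureI) simp
  then show ?thesis by (simp add: finite_measure_def)
qed

lemma sets_idx_fibre:
  assumes "idx \<in> borel \<rightarrow>\<^sub>M count_space UNIV"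
  shows "{x\<in>{0..1}. idx x = i} \<in> sets unit_interval_measure"
proof -
  have "{x \<in> space borel. idx x = i} \<in> sets borel"
    using assms by measurable
  then have "{x\<in>{0..1}. idx x = i} \<in> sets lborel"
    by (simp add: Collect_conj_eq sets.Int)
  then show ?thesis
    unfolding unit_interval_measure_def by (subst sets_restrict_space_iff) auto
qed

lemma measure_box:
  assumes "finite D" "\<phi> \<in> D \<rightarrow>\<^sub>E {..<n}" "\<And>i. C i \<in> sets unit_interval_measure"
    "\<And>i. i < n \<Longrightarrow> emeasure unit_interval_measure (C i) = ennreal (1 / real n)"
  shows "PiE D (\<lambda>u. C (\<phi> u)) \<in> sets (\<Pi>\<^sub>M u\<in>D. unit_interval_measure)"
    "emeasure (\<Pi>\<^sub>M u\<in>D. unit_interval_measure) (PiE D (\<lambda>u. C (\<phi> u))) = ennreal ((1 / real n) ^ card D)"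
proof -
  let ?U = "unit_interval_measure"
  interpret U: sigma_finite_measure ?U by (rule sigma_finite_unit_interval_measure)
  interpret product_sigma_finite "\<lambda>_. ?U" by standard
  show "PiE D (\<lambda>u. C (\<phi> u)) \<in> sets (\<Pi>\<^sub>M u\<in>D. ?U)" by (intro sets_PiM_I_finite assms)
  have "emeasure (\<Pi>\<^sub>M u\<in>D. ?U) (PiE D (\<lambda>u. C (\<phi> u))) = (\<Prod>u\<in>D. emeasure ?U (C (\<phi> u)))"
    by (intro emeasure_PiM assms)
  also have "\<dots> = (\<Prod>u\<in>D. ennreal (1 / real n))"
    using assms(2) by (intro prod.cong refl assms(4)) auto
  also have "\<dots> = ennreal ((1 / real n) ^ card D)" by (simp add: ennreal_power)
  finally show "emeasure (\<Pi>\<^sub>M u\<in>D. ?U) (PiE D (\<lambda>u. C (\<phi> u))) = ennreal ((1 / real n) ^ card D)" .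
qed

text \<open>The integrand is constant on each product of cells, one product for each pair of vertex
  maps, and all these boxes have the same measure.\<close>

lemma hom_density_step:
  assumes fin: "finite A" "finite B" and E: "E \<subseteq> A \<times> B" and n: "n > 0"
    and idx: "idx \<in> borel \<rightarrow>\<^sub>M count_space UNIV" "\<And>x. idx x < n"
    and cell: "\<And>i. i < n \<Longrightarrow>
      emeasure unit_interval_measure {x\<in>{0..1}. idx x = i} = ennreal (1 / real n)"
  shows "hom_density A B E (\<lambda>z. W (idx (fst z)) (idx (snd z)))
    = hom_sum A B E {..<n} W / real n ^ (card A + card B)"
proof -
  let ?U = "unit_interval_measure"
  let ?P = "\<Pi>\<^sub>M u\<in>A. ?U" and ?Q = "\<Pi>\<^sub>M v\<in>B. ?U"
  interpret U: sigma_finite_measure ?U by (rule sigma_finite_unit_interval_measure)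
  interpret product_sigma_finite "\<lambda>_. ?U" by standard
  interpret Q: finite_product_sigma_finite "\<lambda>_. ?U" B by standard (rule fin)
  define C where "C i = {x\<in>{0..1::real}. idx x = i}" for i
  have C: "C i \<in> sets ?U" for i unfolding C_def by (rule sets_idx_fibre[OF idx(1)])
  have cellC: "i < n \<Longrightarrow> emeasure ?U (C i) = ennreal (1 / real n)" for i
    unfolding C_def by (rule cell)
  note box = measure_box[of _ _ _ C, OF _ _ C cellC]
  define c where "c \<phi> \<psi> = (\<Prod>e\<in>E. W (\<phi> (fst e)) (\<psi> (snd e)))" for \<phi> :: "'a \<Rightarrow> nat" and \<psi> :: "'b \<Rightarrow> nat"
  define S where "S \<phi> \<psi> = PiE A (\<lambda>u. C (\<phi> u)) \<times> PiE B (\<lambda>v. C (\<psi> v))" for \<phi> \<psi>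
  let ?g = "\<lambda>xy. \<Sum>\<phi>\<in>A \<rightarrow>\<^sub>E {..<n}. \<Sum>\<psi>\<in>B \<rightarrow>\<^sub>E {..<n}. c \<phi> \<psi> * indicator (S \<phi> \<psi>) xy"
  let ?r = "(1 / real n) ^ card A * (1 / real n) ^ card B"
  have g: "has_bochner_integral (?P \<Otimes>\<^sub>M ?Q) ?g (\<Sum>\<phi>\<in>A \<rightarrow>\<^sub>E {..<n}. \<Sum>\<psi>\<in>B \<rightarrow>\<^sub>E {..<n}. c \<phi> \<psi> * ?r)"
  proof (intro has_bochner_integral_sum has_bochner_integral_mult_right)
    fix \<phi> \<psi> assume \<phi>: "\<phi> \<in> A \<rightarrow>\<^sub>E {..<n}" and \<psi>: "\<psi> \<in> B \<rightarrow>\<^sub>E {..<n}"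
    have "emeasure (?P \<Otimes>\<^sub>M ?Q) (S \<phi> \<psi>) = ennreal ?r"
      unfolding S_def using box[OF fin(1) \<phi>] box[OF fin(2) \<psi>]
      by (simp add: Q.emeasure_pair_measure_Times ennreal_mult)
    moreover have "S \<phi> \<psi> \<in> sets (?P \<Otimes>\<^sub>M ?Q)"
      unfolding S_def using box[OF fin(1) \<phi>] box[OF fin(2) \<psi>] by auto
    ultimately show "has_bochner_integral (?P \<Otimes>\<^sub>M ?Q) (indicator (S \<phi> \<psi>)) ?r"
      using has_bochner_integral_real_indicator[of "S \<phi> \<psi>" "?P \<Otimes>\<^sub>M ?Q"] by (simp add: measure_def)
  qed
  have eq: "(\<Prod>(u, v)\<in>E. W (idx (fst xy u)) (idx (snd xy v))) = ?g xy"
    if "xy \<in> space (?P \<Otimes>\<^sub>M ?Q)" for xy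
  proof -
    define \<phi>0 where "\<phi>0 = (\<lambda>u\<in>A. idx (fst xy u))"
    define \<psi>0 where "\<psi>0 = (\<lambda>v\<in>B. idx (snd xy v))"
    have mem: "fst xy \<in> A \<rightarrow>\<^sub>E {0..1}" "snd xy \<in> B \<rightarrow>\<^sub>E {0..1}"
      using that by (auto simp: space_pair_measure space_PiM)
    \<comment> \<open>A point lies in exactly one box, the one given by the cells of its own
      coordinates, so a single summand of \<open>?g\<close> survives.\<close>
    have ind: "c \<phi> \<psi> * indicator (S \<phi> \<psi>) xy = (if \<psi> = \<psi>0 then if \<phi> = \<phi>0 then c \<phi> \<psi> else 0 else 0)"
      if "\<phi> \<in> A \<rightarrow>\<^sub>E {..<n}" "\<psi> \<in> B \<rightarrow>\<^sub>E {..<n}" for \<phi> \<psi>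
    proof -
      have "fst xy \<in> PiE A (\<lambda>u. C (\<phi> u)) \<longleftrightarrow> \<phi> = \<phi>0"
        using mem(1) that(1) by (fastforce simp: C_def \<phi>0_def PiE_iff extensional_def fun_eq_iff restrict_def)
      moreover have "snd xy \<in> PiE B (\<lambda>v. C (\<psi> v)) \<longleftrightarrow> \<psi> = \<psi>0"
        using mem(2) that(2) by (fastforce simp: C_def \<psi>0_def PiE_iff extensional_def fun_eq_iff restrict_def)
      ultimately show ?thesis by (auto simp: S_def indicator_def mem_Times_iff)
    qed
    have "\<phi>0 \<in> A \<rightarrow>\<^sub>E {..<n}" "\<psi>0 \<in> B \<rightarrow>\<^sub>E {..<n}" using idx(2) by (auto simp: \<phi>0_def \<psi>0_def)
    then have "?g xy = c \<phi>0 \<psi>0"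
      using fin by (simp add: ind finite_PiE cong: sum.cong)
    also have "\<dots> = (\<Prod>(u, v)\<in>E. W (idx (fst xy u)) (idx (snd xy v)))"
      unfolding c_def \<phi>0_def \<psi>0_def using E by (intro prod.cong refl) auto
    finally show ?thesis ..
  qed
  have "hom_density A B E (\<lambda>z. W (idx (fst z)) (idx (snd z)))
      = (\<integral>xy. ?g xy \<partial>completion (?P \<Otimes>\<^sub>M ?Q))"
    unfolding hom_density_def fst_conv snd_conv
    by (rule Bochner_Integration.integral_cong[OF refl]) (simp only: space_completion eq)
  \<comment> \<open>The finite sum of indicators is measurable already for the uncompleted product,
    so the completion does not affect the integral.\<close>
  also have "\<dots> = (\<integral>xy. ?g xy \<partial>(?P \<Otimes>\<^sub>M ?Q))"
    by (rule integral_completion) (rule borel_measurable_has_bochner_integral[OF g])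
  also have "\<dots> = (\<Sum>\<phi>\<in>A \<rightarrow>\<^sub>E {..<n}. \<Sum>\<psi>\<in>B \<rightarrow>\<^sub>E {..<n}. c \<phi> \<psi> * ?r)"
    by (rule has_bochner_integral_integral_eq[OF g])
  also have "\<dots> = hom_sum A B E {..<n} W / real n ^ (card A + card B)"
    by (simp only: sum_distrib_right[symmetric]) (simp add: hom_sum_def c_def power_add power_divide)
  finally show ?thesis .
qed


section \<open>Norm axioms passed to matrices\<close>

lemma step_function_bounded_measurable:
  assumes "idx \<in> borel \<rightarrow>\<^sub>M count_space UNIV" "\<And>x::real. idx x < (n::nat)"
  shows "(\<lambda>z. W (idx (fst z)) (idx (snd z))) \<in> bounded_measurable"
proof -
  let ?f = "\<lambda>z :: real \<times> real. W (idx (fst z)) (idx (snd z)) :: real"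
  have "?f \<in> borel_measurable borel"
  proof -
    have 1: "(\<lambda>z :: real \<times> real. idx (fst z)) \<in> borel \<rightarrow>\<^sub>M count_space UNIV"
      by (rule measurable_compose[OF _ assms(1)]) (simp add: borel_measurable_continuous_onI continuous_on_fst)
    have 2: "(\<lambda>z :: real \<times> real. idx (snd z)) \<in> borel \<rightarrow>\<^sub>M count_space UNIV"
      by (rule measurable_compose[OF _ assms(1)]) (simp add: borel_measurable_continuous_onI continuous_on_snd)
    show ?thesis
      by (rule measurable_compose_countable[OF _ 1], rule measurable_compose_countable[OF _ 2]) simp
  qed
  then have "?f \<in> borel_measurable (lebesgue_on unit_square)"
    by (intro measurable_restrict_space1 measurable_completion) simp
  moreover have "bounded (?f ` unit_square)"
  proof (rule finite_imp_bounded, rule finite_subset)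
    show "?f ` unit_square \<subseteq> (\<lambda>(i, j). W i j) ` ({..<n} \<times> {..<n})"
      using assms(2) by force
  qed simp
  ultimately show ?thesis by (simp add: bounded_measurable_def)
qed

text \<open>All three step functions use the same partition, so their densities carry the same
  normalisation, whose root \<open>r\<close> cancels from the triangle inequality.\<close>

lemma norming_hom_sum_triangle_nat:
  assumes N: "norming A B E" and fin: "finite A" "finite B" and E: "E \<subseteq> A \<times> B" and n: "(n::nat) > 0"
  shows "\<bar>hom_sum A B E {..<n} (\<lambda>x y. V x y + W x y)\<bar> powr (1 / real (card E))
    \<le> \<bar>hom_sum A B E {..<n} V\<bar> powr (1 / real (card E)) + \<bar>hom_sum A B E {..<n} W\<bar> powr (1 / real (card E))"
proof -
  obtain idx where idx: "idx \<in> borel \<rightarrow>\<^sub>M count_space UNIV" "\<And>x::real. idx x < n"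
    "\<And>i. i < n \<Longrightarrow> emeasure unit_interval_measure {x\<in>{0..1}. idx x = i} = ennreal (1 / real n)"
    using equal_partition_unit_interval[OF n] by blast
  define f where "f W z = W (idx (fst z)) (idx (snd z))" for W :: "nat \<Rightarrow> nat \<Rightarrow> real" and z
  have hd1: "hom_density A B E (f W) = hom_sum A B E {..<n} W / real n ^ (card A + card B)" for W
    unfolding f_def by (rule hom_density_step[OF fin E n idx])
  define r where "r = (real n ^ (card A + card B)) powr (1 / real (card E))"
  have r: "r > 0" using n by (simp add: r_def)
  have gn: "graph_norm A B E (f W) = \<bar>hom_sum A B E {..<n} W\<bar> powr (1 / real (card E)) / r" for W
    unfolding graph_norm_def hd1 r_def
    by (simp add: powr_divide abs_divide)
  have "f W \<in> bounded_measurable" for W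
    unfolding f_def using idx by (intro step_function_bounded_measurable)
  then have "graph_norm A B E (\<lambda>z. f V z + f W z) \<le> graph_norm A B E (f V) + graph_norm A B E (f W)"
    using N by (auto simp: norming_def seminorm_on_def)
  moreover have "(\<lambda>z. f V z + f W z) = f (\<lambda>x y. V x y + W x y)"
    by (simp add: f_def fun_eq_iff)
  ultimately show ?thesis
    unfolding gn using r by (simp add: add_divide_distrib[symmetric] divide_le_cancel gn)
qed

text \<open>The version for arbitrary index sets, as the test matrix is indexed by a nested
  product.\<close>

lemma norming_hom_sum_triangle:
  fixes I :: "'i set"
  assumes N: "norming A B E" and fin: "finite A" "finite B" and E: "E \<subseteq> A \<times> B"
    and I: "finite I" "I \<noteq> {}"
  shows "\<bar>hom_sum A B E I (\<lambda>x y. V x y + W x y)\<bar> powr (1 / real (card E))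
    \<le> \<bar>hom_sum A B E I V\<bar> powr (1 / real (card E)) + \<bar>hom_sum A B E I W\<bar> powr (1 / real (card E))"
proof -
  obtain h where h: "bij_betw h {..<card I} I"
    using ex_bij_betw_nat_finite[OF I(1)] by (auto simp: lessThan_atLeast0)
  have "card I > 0" using I by (simp add: card_gt_0_iff)
  from norming_hom_sum_triangle_nat[OF N fin E this, of "\<lambda>x y. V (h x) (h y)" "\<lambda>x y. W (h x) (h y)"]
  show ?thesis
    unfolding hom_sum_bij_betw[OF E h, of V] hom_sum_bij_betw[OF E h, of W]
      hom_sum_bij_betw[OF E h, of "\<lambda>x y. V x y + W x y"] .
qed

text \<open>The corresponding step function vanishes nowhere on a square of measure 1. If its
  density were 0, definiteness of the norm would make it 0 almost everywhere.\<close>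

lemma norming_hom_sum_nonzero:
  assumes N: "norming A B E" and fin: "finite A" "finite B" and E: "E \<subseteq> A \<times> B" and n: "(n::nat) > 0"
    and W: "\<And>i j. W i j \<noteq> 0"
  shows "hom_sum A B E {..<n} W \<noteq> 0"
proof
  assume 0: "hom_sum A B E {..<n} W = 0"
  obtain idx where idx: "idx \<in> borel \<rightarrow>\<^sub>M count_space UNIV" "\<And>x::real. idx x < n"
    "\<And>i. i < n \<Longrightarrow> emeasure unit_interval_measure {x\<in>{0..1}. idx x = i} = ennreal (1 / real n)"
    using equal_partition_unit_interval[OF n] by blast
  let ?f = "\<lambda>z. W (idx (fst z)) (idx (snd z))"
  have "graph_norm A B E ?f = 0"
    using hom_density_step[OF fin E n idx, of W] by (simp add: graph_norm_def 0)
  then have "AE z in lebesgue_on unit_square. ?f z = 0"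
    using N step_function_bounded_measurable[OF idx(1,2)] unfolding norming_def by blast
  then have "AE z in lebesgue_on unit_square. False" using W by simp
  then have null: "emeasure (lebesgue_on unit_square) (space (lebesgue_on unit_square)) = 0"
    by (simp only: trivial_limit_def[symmetric] ae_filter_eq_bot_iff)
  have us: "unit_square = cbox (0, 0) (1, 1)" by (auto simp: unit_square_def cbox_Pair_eq)
  have "emeasure (lebesgue_on unit_square) unit_square = emeasure lebesgue unit_square"
    unfolding us by (intro emeasure_restrict_space) auto
  also have "\<dots> = emeasure lborel (cbox (0, 0) (1, 1) :: (real \<times> real) set)"
    unfolding us by simp
  also have "\<dots> = 1"
    by (simp add: emeasure_lborel_cbox_eq Basis_prod_def prod.union_disjoint)
  finally have "emeasure (lebesgue_on unit_square) unit_square = 1" .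
  with null show False by simp
qed

section \<open>Edges and squares of the cube\<close>

definition flip :: "nat \<Rightarrow> (nat \<Rightarrow> nat) \<Rightarrow> nat \<Rightarrow> nat" where
  "flip i v = v(i := 1 - v i)"

text \<open>The edge at \<open>v\<close> in direction \<open>i\<close>, oriented as in
  \<open>cube_edges\<close>. It can be addressed from either end, so vertices of both parities are
  treated alike.\<close>

definition cube_edge :: "nat \<Rightarrow> (nat \<Rightarrow> nat) \<Rightarrow> nat \<Rightarrow> (nat \<Rightarrow> nat) \<times> (nat \<Rightarrow> nat)" where
  "cube_edge d v i = (if v \<in> cube_even d then (v, flip i v) else (flip i v, v))"

lemma cube_verts_bit: "v \<in> cube_verts d \<Longrightarrow> i < d \<Longrightarrow> v i = 0 \<or> v i = 1"
  by (auto simp: cube_verts_def PiE_iff)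

lemma flip_in_cube_verts: "v \<in> cube_verts d \<Longrightarrow> i < d \<Longrightarrow> flip i v \<in> cube_verts d"
  by (auto simp: cube_verts_def flip_def PiE_iff extensional_def)

lemma flip_flip: "v \<in> cube_verts d \<Longrightarrow> i < d \<Longrightarrow> flip i (flip i v) = v"
  using cube_verts_bit[of v d i] by (auto simp: flip_def fun_eq_iff)

lemma flip_commute: "flip i (flip j v) = flip j (flip i v)"
  by (auto simp: flip_def fun_eq_iff)

lemma flip_same_iff: "flip i v j = v j \<longleftrightarrow> i \<noteq> j" if "v \<in> cube_verts d" "j < d"
  using cube_verts_bit[OF that] by (auto simp: flip_def)

lemma flip_eq_iff:
  assumes "v \<in> cube_verts d" "i < d" "j < d"
  shows "flip i v = flip j v \<longleftrightarrow> i = j"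
proof
  assume "flip i v = flip j v"
  then have "flip j v i \<noteq> v i" using flip_same_iff[OF assms(1,2), of i] by simp
  then show "i = j" using flip_same_iff[OF assms(1,2), of j] by simp
qed simp

lemma cube_adj_iff_flip:
  "cube_adj d u v \<longleftrightarrow> u \<in> cube_verts d \<and> (\<exists>i<d. v = flip i u)"
proof
  assume adj: "cube_adj d u v"
  then have uv: "u \<in> cube_verts d" "v \<in> cube_verts d" by (auto simp: cube_adj_def)
  from adj obtain i where i: "{i. i < d \<and> u i \<noteq> v i} = {i}"
    by (auto simp: cube_adj_def card_1_singleton_iff)
  then have iff: "k < d \<and> u k \<noteq> v k \<longleftrightarrow> k = i" for k by (simp add: set_eq_iff)
  then have id: "i < d" "u i \<noteq> v i" by blast+
  have "v k = flip i u k" for k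
  proof (cases "k < d")
    case True
    show ?thesis
    proof (cases "k = i")
      case True
      then show ?thesis
        using id(2) cube_verts_bit[OF uv(1) id(1)] cube_verts_bit[OF uv(2) id(1)] by (auto simp: flip_def)
    next
      case False
      then show ?thesis using iff[of k] True by (simp add: flip_def)
    qed
  next
    case False
    \<comment> \<open>Vertices are extensional functions, so beyond the coordinate range both take
      the default value.\<close>
    then have "u k = undefined" "v k = undefined" using uv by (auto simp: cube_verts_def)
    then show ?thesis using False id(1) by (auto simp: flip_def)
  qed
  then have "v = flip i u" by (rule ext)
  then show "u \<in> cube_verts d \<and> (\<exists>i<d. v = flip i u)" using uv id by blast
next
  assume "u \<in> cube_verts d \<and> (\<exists>i<d. v = flip i u)"
  then obtain i where u: "u \<in> cube_verts d" "i < d" "v = flip i u" by blast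
  have "{k. k < d \<and> u k \<noteq> flip i u k} = {i}"
  proof (intro set_eqI iffI)
    fix k assume "k \<in> {k. k < d \<and> u k \<noteq> flip i u k}"
    then show "k \<in> {i}" using flip_same_iff[OF u(1), of k i] by auto
  next
    fix k assume "k \<in> {i}"
    then show "k \<in> {k. k < d \<and> u k \<noteq> flip i u k}" using flip_same_iff[OF u(1,2), of i] u(2) by auto
  qed
  then show "cube_adj d u v" using u flip_in_cube_verts by (simp add: cube_adj_def)
qed

lemma flip_cube_even_iff:
  assumes "v \<in> cube_verts d" "i < d"
  shows "flip i v \<in> cube_even d \<longleftrightarrow> v \<notin> cube_even d"
proof -
  have "cube_adj d v (flip i v)" using assms by (auto simp: cube_adj_iff_flip)
  from cube_adj_bipartite[OF this] have "v \<in> cube_even d \<longleftrightarrow> flip i v \<in> cube_odd d" .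
  moreover have "flip i v \<in> cube_even d \<or> flip i v \<in> cube_odd d"
    using cube_verts_partition(1)[of d] flip_in_cube_verts[OF assms] by simp
  moreover have "\<not> (flip i v \<in> cube_even d \<and> flip i v \<in> cube_odd d)"
    using cube_verts_partition(2)[of d] by blast
  ultimately show ?thesis by blast
qed

lemma cube_edges_eq: "cube_edges d = {cube_edge d v i | v i. v \<in> cube_verts d \<and> i < d}"
proof (intro set_eqI iffI)
  fix e assume "e \<in> cube_edges d"
  then obtain u v where e: "e = (u, v)" "u \<in> cube_even d" "cube_adj d u v"
    by (auto simp: cube_edges_def)
  then show "e \<in> {cube_edge d v i | v i. v \<in> cube_verts d \<and> i < d}"
    by (auto simp: cube_adj_iff_flip cube_edge_def)
next
  fix e assume "e \<in> {cube_edge d v i | v i. v \<in> cube_verts d \<and> i < d}"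
  then obtain v i where e: "e = cube_edge d v i" "v \<in> cube_verts d" "i < d" by blast
  then have "cube_adj d v (flip i v)" by (auto simp: cube_adj_iff_flip)
  moreover from this have "cube_adj d (flip i v) v" using cube_adj_sym by blast
  moreover have "v \<in> cube_odd d" "flip i v \<in> cube_even d" if "v \<notin> cube_even d"
    using that flip_cube_even_iff[OF e(2,3)] cube_verts_partition(1)[of d] e(2) by simp_all
  moreover have "flip i v \<in> cube_odd d" if "v \<in> cube_even d"
    using that cube_adj_bipartite \<open>cube_adj d v (flip i v)\<close> by blast
  ultimately show "e \<in> cube_edges d"
    unfolding e(1) by (simp add: cube_edges_def cube_edge_def)
qed

lemma cube_edge_in: "v \<in> cube_verts d \<Longrightarrow> i < d \<Longrightarrow> cube_edge d v i \<in> cube_edges d"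
  by (auto simp: cube_edges_eq)

lemma cube_edge_flip:
  assumes "v \<in> cube_verts d" "i < d"
  shows "cube_edge d (flip i v) i = cube_edge d v i"
  using flip_cube_even_iff[OF assms] flip_flip[OF assms] by (auto simp: cube_edge_def)

text \<open>If \<open>v\<close> and \<open>w\<close> have the same parity, equal edges have the same
  first and second ends, whence \<open>v = w\<close>. If the parities differ, \<open>v\<close> must
  be the other end of the edge at \<open>w\<close>.\<close>

lemma cube_edge_eq_iff:
  assumes "v \<in> cube_verts d" "i < d" "w \<in> cube_verts d" "j < d"
  shows "cube_edge d v i = cube_edge d w j \<longleftrightarrow> i = j \<and> (v = w \<or> v = flip i w)"
proof -
  have par: "flip i w \<in> cube_even d \<longleftrightarrow> w \<notin> cube_even d" "flip j w \<in> cube_even d \<longleftrightarrow> w \<notin> cube_even d"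
    using flip_cube_even_iff[OF assms(3)] assms by blast+
  have eq: "flip i w = flip j w \<longleftrightarrow> i = j" by (rule flip_eq_iff[OF assms(3,2,4)])
  have inv: "flip i v = w \<longleftrightarrow> v = flip i w"
    using flip_flip[OF assms(1,2)] flip_flip[OF assms(3,2)] by metis
  show ?thesis
  proof (cases "v \<in> cube_even d \<longleftrightarrow> w \<in> cube_even d")
    case True
    then have "cube_edge d v i = cube_edge d w j \<longleftrightarrow> v = w \<and> flip i w = flip j w"
      by (auto simp: cube_edge_def)
    moreover have "v \<noteq> flip i w" using True par(1) by metis
    ultimately show ?thesis using eq by blast
  next
    case False
    then have "cube_edge d v i = cube_edge d w j \<longleftrightarrow> v = flip j w \<and> flip i v = w"
      by (auto simp: cube_edge_def)
    also have "\<dots> \<longleftrightarrow> v = flip j w \<and> flip i w = flip j w" using inv by metis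
    finally show ?thesis using eq False by metis
  qed
qed

lemma finite_cube: "finite (cube_even d)" "finite (cube_odd d)" "finite (cube_edges d)"
  and cube_edges_subset: "cube_edges d \<subseteq> cube_even d \<times> cube_odd d"
proof -
  show fin: "finite (cube_even d)" "finite (cube_odd d)"
    using finite_cube_verts[of d] by (simp_all add: cube_verts_partition(1))
  show sub: "cube_edges d \<subseteq> cube_even d \<times> cube_odd d" by (auto simp: cube_edges_def)
  show "finite (cube_edges d)" by (rule finite_subset[OF sub]) (simp add: fin)
qed

text \<open>Indexing the edges at a vertex by their directions gives both vertex classes the same
  formula, so that balancedness becomes one condition over all vertices.\<close>

lemma sum_incident:
  assumes "K \<subseteq> cube_edges d"
  shows "u \<in> cube_even d \<Longrightarrow> (\<Sum>e\<in>{e\<in>K. fst e = u}. f e) = (\<Sum>i\<in>{i. i < d \<and> cube_edge d u i \<in> K}. f (cube_edge d u i))"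
    and "v \<in> cube_odd d \<Longrightarrow> (\<Sum>e\<in>{e\<in>K. snd e = v}. f e) = (\<Sum>i\<in>{i. i < d \<and> cube_edge d v i \<in> K}. f (cube_edge d v i))"
proof -
  have inj: "inj_on (cube_edge d w) {i. i < d \<and> cube_edge d w i \<in> K}" if "w \<in> cube_verts d" for w
    using cube_edge_eq_iff[OF that _ that] by (auto simp: inj_on_def)
  {
    assume u: "u \<in> cube_even d"
    then have uv: "u \<in> cube_verts d" by (simp add: cube_verts_partition(1))
    have "{e\<in>K. fst e = u} = cube_edge d u ` {i. i < d \<and> cube_edge d u i \<in> K}"
    proof (intro set_eqI iffI)
      fix e assume e: "e \<in> {e\<in>K. fst e = u}"
      then have "e \<in> cube_edges d" using assms by blast
      then obtain i where "i < d" "snd e = flip i u"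
        using e by (auto simp: cube_edges_def cube_adj_iff_flip)
      then have "e = cube_edge d u i" using e u by (cases e) (auto simp: cube_edge_def)
      then show "e \<in> cube_edge d u ` {i. i < d \<and> cube_edge d u i \<in> K}" using e \<open>i < d\<close> by auto
    qed (use u in \<open>auto simp: cube_edge_def\<close>)
    then show "(\<Sum>e\<in>{e\<in>K. fst e = u}. f e) = (\<Sum>i\<in>{i. i < d \<and> cube_edge d u i \<in> K}. f (cube_edge d u i))"
      by (simp add: sum.reindex[OF inj[OF uv]])
  next
    assume v: "v \<in> cube_odd d"
    then have vv: "v \<in> cube_verts d" and vn: "v \<notin> cube_even d"
      using cube_verts_partition[of d] by auto
    have "{e\<in>K. snd e = v} = cube_edge d v ` {i. i < d \<and> cube_edge d v i \<in> K}"
    proof (intro set_eqI iffI)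
      fix e assume e: "e \<in> {e\<in>K. snd e = v}"
      then have "e \<in> cube_edges d" using assms by blast
      then have "cube_adj d (fst e) v" using e by (auto simp: cube_edges_def)
      then have "cube_adj d v (fst e)" using cube_adj_sym by blast
      then obtain i where "i < d" "fst e = flip i v" by (auto simp: cube_adj_iff_flip)
      then have "e = cube_edge d v i" using e vn by (cases e) (auto simp: cube_edge_def)
      then show "e \<in> cube_edge d v ` {i. i < d \<and> cube_edge d v i \<in> K}" using e \<open>i < d\<close> by auto
    qed (use vn in \<open>auto simp: cube_edge_def\<close>)
    then show "(\<Sum>e\<in>{e\<in>K. snd e = v}. f e) = (\<Sum>i\<in>{i. i < d \<and> cube_edge d v i \<in> K}. f (cube_edge d v i))"
      by (simp add: sum.reindex[OF inj[OF vv]])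
  }
qed

abbreviation cube_balanced where
  "cube_balanced d \<equiv> balanced (cube_even d) (cube_odd d)"

lemma cube_balanced_iff:
  assumes "K \<subseteq> cube_edges d"
  shows "cube_balanced d m P K \<longleftrightarrow>
    (\<forall>v\<in>cube_verts d. int m dvd (\<Sum>i\<in>{i. i < d \<and> cube_edge d v i \<in> K}. sg (cube_edge d v i \<in> P)))"
  unfolding balanced_def cube_verts_partition(1) ball_Un
  by (intro arg_cong2[of _ _ _ _ "(\<and>)"] ball_cong refl) (simp_all only: sum_incident[OF assms])

text \<open>A vertex with a single edge of \<open>K\<close> would have signed degree 1 or -1, which
  no modulus \<open>m \<ge> 2\<close> divides.\<close>

lemma cube_balanced_no_leaf:
  assumes "K \<subseteq> cube_edges d" "m \<ge> 2" "cube_balanced d m P K"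
    and "v \<in> cube_verts d" "i < d" "cube_edge d v i \<in> K"
  shows "\<exists>j<d. j \<noteq> i \<and> cube_edge d v j \<in> K"
proof (rule ccontr)
  assume "\<not> ?thesis"
  then have "{j. j < d \<and> cube_edge d v j \<in> K} = {i}" using assms by auto
  then have "int m dvd sg (cube_edge d v i \<in> P)"
    using assms(3,4) unfolding cube_balanced_iff[OF assms(1)] by fastforce
  then show False using assms(2) by (auto simp: sg_def split: if_splits)
qed

section \<open>4-cycles of the cube\<close>

definition square :: "nat \<Rightarrow> (nat \<Rightarrow> nat) \<Rightarrow> nat \<Rightarrow> nat \<Rightarrow> ((nat \<Rightarrow> nat) \<times> (nat \<Rightarrow> nat)) set" where
  "square d v i j =
     {cube_edge d v i, cube_edge d v j, cube_edge d (flip j v) i, cube_edge d (flip i v) j}"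

definition corners :: "nat \<Rightarrow> ((nat \<Rightarrow> nat) \<times> nat \<times> nat) set" where
  "corners d = {(v, i, j). v \<in> cube_verts d \<and> i < d \<and> j < d \<and> i \<noteq> j}"

text \<open>Start from a vertex \<open>w\<close> with two edges of \<open>K\<close>, leading to
  \<open>x\<close> and \<open>y\<close>. Each of these has a further edge of \<open>K\<close>, which
  makes four edges and so all of \<open>K\<close>. As no vertex is a leaf, the two further edges
  must meet, and the cycle closes.\<close>

lemma small_balanced_is_square:
  assumes K: "K \<subseteq> cube_edges d" "K \<noteq> {}" "card K \<le> 4"
    and no_leaf: "\<And>v i. v \<in> cube_verts d \<Longrightarrow> i < d \<Longrightarrow> cube_edge d v i \<in> K \<Longrightarrow>
      \<exists>j<d. j \<noteq> i \<and> cube_edge d v j \<in> K"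
  shows "\<exists>(v, i, j)\<in>corners d. K = square d v i j"
proof -
  obtain e where e: "e \<in> K" using K(2) by blast
  then have "e \<in> cube_edges d" using K(1) by blast
  then obtain w i where w: "w \<in> cube_verts d" "i < d" and "e = cube_edge d w i"
    unfolding cube_edges_eq by blast
  with e have e1: "cube_edge d w i \<in> K" by simp
  obtain j where j: "j < d" "j \<noteq> i" and e2: "cube_edge d w j \<in> K"
    using no_leaf[OF w e1] by blast
  define x where "x = flip i w"
  define y where "y = flip j w"
  have x: "x \<in> cube_verts d" and y: "y \<in> cube_verts d"
    using w j by (auto simp: x_def y_def flip_in_cube_verts)
  have "cube_edge d x i \<in> K" "cube_edge d y j \<in> K"
    using e1 e2 w j by (simp_all add: x_def y_def cube_edge_flip)
  then obtain l k where l: "l < d" "l \<noteq> i" and e4: "cube_edge d x l \<in> K"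
    and k: "k < d" "k \<noteq> j" and e3: "cube_edge d y k \<in> K"
    using no_leaf x y w(2) j(1) by metis
  have par: "x \<in> cube_even d \<longleftrightarrow> w \<notin> cube_even d" "y \<in> cube_even d \<longleftrightarrow> w \<notin> cube_even d"
    using flip_cube_even_iff w j by (auto simp: x_def y_def)
  have wx: "w = flip i x" and wy: "w = flip j y"
    using flip_flip[OF w] flip_flip[OF w(1) j(1)] by (simp_all add: x_def y_def)
  have flip_par: "flip l x \<in> cube_even d \<longleftrightarrow> w \<in> cube_even d" "flip k y \<in> cube_even d \<longleftrightarrow> w \<in> cube_even d"
    "flip k x \<in> cube_even d \<longleftrightarrow> w \<in> cube_even d"
    using flip_cube_even_iff[OF x l(1)] flip_cube_even_iff[OF y k(1)] flip_cube_even_iff[OF x k(1)] par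
    by simp_all
  \<comment> \<open>Vertices of opposite parity are distinct; this and \<open>xy\<close> settle the
    distinctness of the four edges.\<close>
  have ne: "w \<noteq> x" "w \<noteq> y" "y \<noteq> flip k x" using par flip_par by metis+
  have xy: "x \<noteq> y" "flip i y \<noteq> w" "flip j x \<noteq> w"
    using flip_eq_iff[OF w j(1)] flip_eq_iff[OF y w(2) j(1)] flip_eq_iff[OF x j(1) w(2)] j(2) wx wy
    unfolding x_def[symmetric] y_def[symmetric] by metis+
  have "cube_edge d w i \<noteq> cube_edge d w j"
    using cube_edge_eq_iff[OF w w(1) j(1)] j(2) by simp
  moreover have "cube_edge d w i \<noteq> cube_edge d y k"
    using cube_edge_eq_iff[OF w y k(1)] ne(2) xy(2) by metis
  moreover have "cube_edge d w i \<noteq> cube_edge d x l"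
    using cube_edge_eq_iff[OF w x l(1)] l(2) by simp
  moreover have "cube_edge d w j \<noteq> cube_edge d y k"
    using cube_edge_eq_iff[OF w(1) j(1) y k(1)] k(2) by simp
  moreover have "cube_edge d w j \<noteq> cube_edge d x l"
    using cube_edge_eq_iff[OF w(1) j(1) x l(1)] ne(1) xy(3) by metis
  moreover have "cube_edge d y k \<noteq> cube_edge d x l"
    using cube_edge_eq_iff[OF y k(1) x l(1)] xy(1) ne(3) by metis
  ultimately have c4: "card {cube_edge d w i, cube_edge d w j, cube_edge d y k, cube_edge d x l} = 4"
    by simp
  have "finite K" using K(1) finite_cube(3) finite_subset by blast
  then have Keq: "K = {cube_edge d w i, cube_edge d w j, cube_edge d y k, cube_edge d x l}"
    using card_seteq[of K "{cube_edge d w i, cube_edge d w j, cube_edge d y k, cube_edge d x l}"]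
      K(3) c4 e1 e2 e3 e4 by simp
  \<comment> \<open>The far end of the second edge at \<open>y\<close>. It needs another edge of
    \<open>K\<close>, and among the four only the second edge at \<open>x\<close> can reach
    it.\<close>
  define q where "q = flip k y"
  have q: "q \<in> cube_verts d" using y k by (simp add: q_def flip_in_cube_verts)
  have "cube_edge d q k \<in> K" using e3 y k by (simp add: q_def cube_edge_flip)
  then obtain p where p: "p < d" "p \<noteq> k" "cube_edge d q p \<in> K" using no_leaf[OF q k(1)] by blast
  have qw: "q \<noteq> w"
  proof
    assume "q = w"
    then have "flip k y = flip j y" using wy unfolding q_def by metis
    then show False using flip_eq_iff[OF y k(1) j(1)] k(2) by metis
  qed
  have qpar: "q \<in> cube_even d \<longleftrightarrow> w \<in> cube_even d" using flip_par(2) by (simp add: q_def)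
  then have qxy: "q \<noteq> x" "q \<noteq> y" using par by metis+
  have "cube_edge d q p = cube_edge d w i \<or> cube_edge d q p = cube_edge d w j
      \<or> cube_edge d q p = cube_edge d y k \<or> cube_edge d q p = cube_edge d x l"
    using p(3) unfolding Keq by blast
  then have "q = flip l x"
  proof (elim disjE)
    assume "cube_edge d q p = cube_edge d w i"
    then show ?thesis using cube_edge_eq_iff[OF q p(1) w] qw qxy(1) unfolding x_def by metis
  next
    assume "cube_edge d q p = cube_edge d w j"
    then show ?thesis using cube_edge_eq_iff[OF q p(1) w(1) j(1)] qw qxy(2) unfolding y_def by metis
  next
    assume "cube_edge d q p = cube_edge d y k"
    then show ?thesis using cube_edge_eq_iff[OF q p(1) y k(1)] p(2) by metis
  next
    assume "cube_edge d q p = cube_edge d x l"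
    then show ?thesis using cube_edge_eq_iff[OF q p(1) x l(1)] qxy(1) by metis
  qed
  then have "flip k (flip j w) = flip l (flip i w)" by (simp add: q_def x_def y_def)
  \<comment> \<open>Two paths of length 2 from \<open>w\<close> end at the same vertex. Coordinate
    \<open>i\<close> changes along the second path, hence along the first, which forces
    \<open>k = i\<close>; coordinate \<open>j\<close> gives \<open>l = j\<close> in the same
    way.\<close>
  then have "flip k (flip j w) i = flip l (flip i w) i" "flip k (flip j w) j = flip l (flip i w) j"
    by (rule fun_cong)+
  then have "k = i" "l = j"
    using cube_verts_bit[OF w] cube_verts_bit[OF w(1) j(1)] k(2) l(2) j(2)
    by (auto simp: flip_def split: if_splits)
  then have "K = square d w i j" unfolding Keq square_def x_def y_def by simp
  then show ?thesis using w j by (auto simp: corners_def)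
qed

lemma square_swap: "square d v j i = square d v i j"
  by (auto simp: square_def)

lemma square_flip:
  assumes "v \<in> cube_verts d" "i < d" "j < d"
  shows "square d (flip i v) i j = square d v i j"
proof -
  have "cube_edge d (flip j (flip i v)) i = cube_edge d (flip j v) i"
    unfolding flip_commute[of j i v] by (rule cube_edge_flip[OF flip_in_cube_verts[OF assms(1,3)] assms(2)])
  then show ?thesis
    unfolding square_def cube_edge_flip[OF assms(1,2)] flip_flip[OF assms(1,2)] by auto
qed

lemma mem_squareD:
  assumes "(v, i, j) \<in> corners d" "x \<in> cube_verts d" "k < d" "cube_edge d x k \<in> square d v i j"
  shows "k \<in> {i, j} \<and> x \<in> {v, flip i v, flip j v, flip i (flip j v)}"
proof -
  have v: "v \<in> cube_verts d" "i < d" "j < d" using assms(1) by (auto simp: corners_def)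
  have fv: "flip i v \<in> cube_verts d" "flip j v \<in> cube_verts d" using v by (simp_all add: flip_in_cube_verts)
  from assms(4) have "cube_edge d x k = cube_edge d v i \<or> cube_edge d x k = cube_edge d v j \<or>
      cube_edge d x k = cube_edge d (flip j v) i \<or> cube_edge d x k = cube_edge d (flip i v) j"
    by (simp add: square_def)
  then show ?thesis
  proof (elim disjE)
    assume "cube_edge d x k = cube_edge d v i"
    then show ?thesis using cube_edge_eq_iff[OF assms(2,3) v(1,2)] by blast
  next
    assume "cube_edge d x k = cube_edge d v j"
    then show ?thesis using cube_edge_eq_iff[OF assms(2,3) v(1,3)] by blast
  next
    assume "cube_edge d x k = cube_edge d (flip j v) i"
    then show ?thesis using cube_edge_eq_iff[OF assms(2,3) fv(2) v(2)] by blast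
  next
    assume "cube_edge d x k = cube_edge d (flip i v) j"
    then show ?thesis using cube_edge_eq_iff[OF assms(2,3) fv(1) v(3)] flip_commute[of i j v]
      by (metis insertCI)
  qed
qed

lemma square_edges_at:
  assumes "(v, i, j) \<in> corners d" "x \<in> cube_verts d"
  shows "{k. k < d \<and> cube_edge d x k \<in> square d v i j}
    = (if x \<in> {v, flip i v, flip j v, flip i (flip j v)} then {i, j} else {})"
proof -
  have v: "v \<in> cube_verts d" "i < d" "j < d" using assms(1) by (auto simp: corners_def)
  have fv: "flip i v \<in> cube_verts d" "flip j v \<in> cube_verts d" using v by (simp_all add: flip_in_cube_verts)
  have "cube_edge d (flip i (flip j v)) j = cube_edge d (flip i v) j"
    unfolding flip_commute[of i j v] by (rule cube_edge_flip[OF fv(1) v(3)])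
  then have in_sq: "cube_edge d x i \<in> square d v i j \<and> cube_edge d x j \<in> square d v i j"
    if "x \<in> {v, flip i v, flip j v, flip i (flip j v)}"
    using that cube_edge_flip[OF v(1,2)] cube_edge_flip[OF v(1,3)] cube_edge_flip[OF fv(2) v(2)]
    unfolding square_def by auto
  have only: "k = i \<or> k = j" "x \<in> {v, flip i v, flip j v, flip i (flip j v)}"
    if "k < d" "cube_edge d x k \<in> square d v i j" for k
    using mem_squareD[OF assms that] by blast+
  show ?thesis
  proof (cases "x \<in> {v, flip i v, flip j v, flip i (flip j v)}")
    case True
    have "k < d \<and> cube_edge d x k \<in> square d v i j \<longleftrightarrow> k \<in> {i, j}" for k
      using in_sq[OF True] only(1)[of k] v(2,3) by blast
    then show ?thesis by (simp only: True if_True Collect_mem_eq)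
  next
    case False
    then have "{k. k < d \<and> cube_edge d x k \<in> square d v i j} = {}" using only(2) by blast
    then show ?thesis by (simp only: False if_False)
  qed
qed

lemma square_subset: "(v, i, j) \<in> corners d \<Longrightarrow> square d v i j \<subseteq> cube_edges d"
  by (auto simp: square_def corners_def intro!: cube_edge_in flip_in_cube_verts)

lemma flip_neq: "v \<in> cube_verts d \<Longrightarrow> i < d \<Longrightarrow> flip i v \<noteq> v"
  using flip_same_iff[of v d i i] by metis

lemma flip_flip_neq:
  assumes "v \<in> cube_verts d" "i < d" "j < d" "i \<noteq> j"
  shows "flip i (flip j v) \<noteq> v"
proof
  assume "flip i (flip j v) = v"
  then have "flip i (flip j v) j = v j" by simp
  then have "flip j v j = v j" using assms(4) by (simp add: flip_def)
  then show False using flip_same_iff[OF assms(1,3), of j] by simp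
qed

lemma square_distinct:
  assumes "(v, i, j) \<in> corners d"
  shows "distinct [cube_edge d v i, cube_edge d v j, cube_edge d (flip j v) i, cube_edge d (flip i v) j]"
proof -
  have v: "v \<in> cube_verts d" "i < d" "j < d" "i \<noteq> j" using assms(1) by (auto simp: corners_def)
  have fv: "flip i v \<in> cube_verts d" "flip j v \<in> cube_verts d" using v by (simp_all add: flip_in_cube_verts)
  have "flip j v \<noteq> v" "flip i (flip j v) \<noteq> v" "flip i v \<noteq> v" "flip j (flip i v) \<noteq> v"
    using flip_neq[OF v(1,2)] flip_neq[OF v(1,3)] flip_flip_neq[OF v] flip_flip_neq[OF v(1,3,2)] v(4) by simp_all
  note ne = this this[symmetric]
  show ?thesis
    using cube_edge_eq_iff[OF v(1,2) v(1,3)] cube_edge_eq_iff[OF v(1,2) fv(2) v(2)]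
      cube_edge_eq_iff[OF v(1,2) fv(1) v(3)] cube_edge_eq_iff[OF v(1,3) fv(2) v(2)]
      cube_edge_eq_iff[OF v(1,3) fv(1) v(3)] cube_edge_eq_iff[OF fv(2) v(2) fv(1) v(3)] ne v(4)
    by simp
qed

lemma card_square: "(v, i, j) \<in> corners d \<Longrightarrow> card (square d v i j) = 4"
  using square_distinct[of v i j d] by (simp add: square_def)

lemma finite_corners: "finite (corners d)"
  by (rule finite_subset[of _ "cube_verts d \<times> {..<d} \<times> {..<d}"])
    (auto simp: corners_def finite_cube_verts)

text \<open>A square can be described from any of its four vertices and with its two directions in
  either order.\<close>

lemma card_square_fibre:
  assumes t: "(w, a, b) \<in> corners d"
  shows "card {(v, i, j)\<in>corners d. square d v i j = square d w a b} = 8"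
proof -
  have w: "w \<in> cube_verts d" "a < d" "b < d" "a \<noteq> b" using t by (auto simp: corners_def)
  let ?V = "{w, flip a w, flip b w, flip a (flip b w)}"
  have "{(v, i, j)\<in>corners d. square d v i j = square d w a b} = ?V \<times> {(a, b), (b, a)}"
  proof (intro set_eqI iffI)
    fix t assume "t \<in> {(v, i, j)\<in>corners d. square d v i j = square d w a b}"
    then obtain v i j where v: "t = (v, i, j)" "(v, i, j) \<in> corners d" "square d v i j = square d w a b"
      by auto
    then have "cube_edge d v i \<in> square d w a b" "cube_edge d v j \<in> square d w a b"
      by (auto simp: square_def)
    moreover have "v \<in> cube_verts d" "i < d" "j < d" "i \<noteq> j" using v(2) by (auto simp: corners_def)
    ultimately have "i \<in> {a, b} \<and> v \<in> ?V" "j \<in> {a, b}" "i \<noteq> j"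
      using mem_squareD[OF t, of v i] mem_squareD[OF t, of v j] by blast+
    then show "t \<in> ?V \<times> {(a, b), (b, a)}" using v(1) by blast
  next
    fix t assume "t \<in> ?V \<times> {(a, b), (b, a)}"
    then obtain v i j where t: "t = (v, i, j)" "v \<in> ?V" and ij: "i = a \<and> j = b \<or> i = b \<and> j = a"
      by blast
    have "v \<in> cube_verts d \<and> square d v a b = square d w a b"
    proof -
      have fw: "flip a w \<in> cube_verts d" "flip b w \<in> cube_verts d" "flip a (flip b w) \<in> cube_verts d"
        using w by (simp_all add: flip_in_cube_verts)
      have "square d (flip b w) a b = square d w a b"
        using square_flip[OF w(1,3,2)] square_swap[of d _ a b] by simp
      then show ?thesis
        using t(2) w(1) fw square_flip[OF w(1,2,3)] square_flip[OF fw(2) w(2,3)]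
        by (elim insertE) simp_all
    qed
    then have "(v, i, j) \<in> corners d \<and> square d v i j = square d w a b"
      using w(2,3,4) ij square_swap[of d v a b] by (elim disjE) (simp_all add: corners_def)
    then show "t \<in> {(v, i, j)\<in>corners d. square d v i j = square d w a b}"
      unfolding t(1) by simp
  qed
  moreover have "card ?V = 4"
  proof -
    have fw: "flip b w \<in> cube_verts d" using w by (simp add: flip_in_cube_verts)
    have "flip a w \<noteq> w" "flip b w \<noteq> w" "flip a (flip b w) \<noteq> flip b w"
      by (rule flip_neq[OF w(1,2)], rule flip_neq[OF w(1,3)], rule flip_neq[OF fw w(2)])
    moreover have "flip a w \<noteq> flip b w" using flip_eq_iff[OF w(1,2,3)] w(4) by simp
    moreover have "flip a (flip b w) \<noteq> w" by (rule flip_flip_neq[OF w])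
    moreover have "flip a (flip b w) \<noteq> flip a w"
      using flip_neq[OF flip_in_cube_verts[OF w(1,2)] w(3)] flip_commute[of a b w] by simp
    ultimately have "distinct [w, flip a w, flip b w, flip a (flip b w)]"
      by (simp add: not_sym)
    then show ?thesis by simp
  qed
  ultimately have "card {(v, i, j)\<in>corners d. square d v i j = square d w a b} = 4 * card {(a, b), (b, a)}"
    by (simp only: card_cartesian_product)
  then show ?thesis using w(4) by simp
qed

text \<open>Double counting: a balanced set of four edges is a square, and each square has eight
  descriptions by a corner and an ordered pair of directions. Sums over such triples need no choice
  of representatives.\<close>

lemma sum_squares:
  fixes g :: "_ \<Rightarrow> real"
  assumes m: "m \<ge> 2"
  shows "(\<Sum>K\<in>{K\<in>Pow (cube_edges d). cube_balanced d m P K \<and> card K = 4}. g K)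
    = (\<Sum>(v, i, j)\<in>{(v, i, j)\<in>corners d. cube_balanced d m P (square d v i j)}. g (square d v i j)) / 8"
proof -
  let ?S = "{K\<in>Pow (cube_edges d). cube_balanced d m P K \<and> card K = 4}"
  let ?C = "{(v, i, j)\<in>corners d. cube_balanced d m P (square d v i j)}"
  let ?q = "\<lambda>(v, i, j). square d v i j"
  have "(\<Sum>t\<in>?C. g (?q t)) = (\<Sum>K\<in>?S. \<Sum>t\<in>{t\<in>?C. ?q t = K}. g (?q t))"
    by (rule sum.group[symmetric])
      (auto simp: finite_cube finite_corners card_square dest: square_subset[THEN subsetD]
        intro: finite_subset[OF _ finite_corners])
  also have "\<dots> = (\<Sum>K\<in>?S. 8 * g K)"
  proof (rule sum.cong[OF refl])
    fix K assume K: "K \<in> ?S"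
    then have "K \<noteq> {}" by auto
    then obtain w a b where t: "(w, a, b) \<in> corners d" and Kq: "K = square d w a b"
      using small_balanced_is_square[of K d] K cube_balanced_no_leaf[of K d m P] m by fastforce
    have "{t\<in>?C. ?q t = K} = {(v, i, j)\<in>corners d. square d v i j = square d w a b}"
      using K Kq by auto
    then have "card {t\<in>?C. ?q t = K} = 8" using card_square_fibre[OF t] by simp
    moreover have "(\<Sum>t\<in>{t\<in>?C. ?q t = K}. g (?q t)) = (\<Sum>t\<in>{t\<in>?C. ?q t = K}. g K)"
      by (rule sum.cong) auto
    ultimately show "(\<Sum>t\<in>{t\<in>?C. ?q t = K}. g (?q t)) = 8 * g K" by simp
  qed
  also have "\<dots> = 8 * (\<Sum>K\<in>?S. g K)" by (rule sum_distrib_left[symmetric])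
  finally show ?thesis by (simp add: case_prod_beta)
qed

section \<open>Expansion near the constant function\<close>

text \<open>A crude tail bound: there are at most \<open>2 ^ card (cube_edges d)\<close> summands,
  and as \<open>\<epsilon> \<le> 1\<close> each is at most \<open>\<epsilon> ^ r\<close>.\<close>

lemma abs_balanced_sum_le:
  fixes w :: "_ \<Rightarrow> real"
  assumes "0 \<le> \<epsilon>" "\<epsilon> \<le> 1" and w: "\<And>K. K \<subseteq> cube_edges d \<Longrightarrow> \<bar>w K\<bar> \<le> 1"
    and S: "S \<subseteq> Pow (cube_edges d)" "\<And>K. K \<in> S \<Longrightarrow> r \<le> card K"
  shows "\<bar>\<Sum>K\<in>S. \<epsilon> ^ card K * w K\<bar> \<le> 2 ^ card (cube_edges d) * \<epsilon> ^ r"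
proof -
  have "\<bar>\<Sum>K\<in>S. \<epsilon> ^ card K * w K\<bar> \<le> (\<Sum>K\<in>S. \<bar>\<epsilon> ^ card K * w K\<bar>)" by (rule sum_abs)
  also have "\<dots> \<le> (\<Sum>K\<in>S. \<epsilon> ^ r)"
  proof (rule sum_mono)
    fix K assume "K \<in> S"
    then have "\<epsilon> ^ card K \<le> \<epsilon> ^ r" "\<bar>w K\<bar> \<le> 1"
      using assms by (auto intro: power_decreasing)
    then have "\<epsilon> ^ card K * \<bar>w K\<bar> \<le> \<epsilon> ^ r * 1"
      using assms(1) by (intro mult_mono) auto
    then show "\<bar>\<epsilon> ^ card K * w K\<bar> \<le> \<epsilon> ^ r" using assms(1) by (simp add: abs_mult)
  qed
  also have "\<dots> = real (card S) * \<epsilon> ^ r" by simp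
  also have "\<dots> \<le> 2 ^ card (cube_edges d) * \<epsilon> ^ r"
  proof (rule mult_right_mono)
    have "card S \<le> card (Pow (cube_edges d))"
      using S(1) finite_cube(3) by (intro card_mono) auto
    then have "card S \<le> 2 ^ card (cube_edges d)" by (simp add: card_Pow finite_cube)
    then have "real (card S) \<le> real (2 ^ card (cube_edges d))" by (simp only: of_nat_le_iff)
    then show "real (card S) \<le> 2 ^ card (cube_edges d)" by simp
  qed (use assms(1) in simp)
  finally show ?thesis .
qed

lemma cube_balanced_cases:
  assumes "m \<ge> 2" "K \<subseteq> cube_edges d" "cube_balanced d m P K"
  shows "K = {} \<or> card K = 4 \<or> 5 \<le> card K"
proof (rule ccontr)
  assume *: "\<not> ?thesis"
  then have "\<exists>(v, i, j)\<in>corners d. K = square d v i j"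
    using assms cube_balanced_no_leaf[OF assms(2,1,3)]
    by (intro small_balanced_is_square) auto
  then show False using * card_square by auto
qed

text \<open>The empty set contributes the 1, no balanced set has one to three edges, those with four
  are the squares, and the rest is of order \<open>\<epsilon> ^ 5\<close>. The weight
  \<open>w\<close> is left open to cover both the selecting factor, with weight 1, and the factor
  that depends on \<open>z\<close>.\<close>

lemma cube_balanced_expansion:
  fixes w :: "_ \<Rightarrow> real" and P :: "((nat \<Rightarrow> nat) \<times> (nat \<Rightarrow> nat)) set"
  assumes m: "m \<ge> 2" and \<epsilon>: "0 \<le> \<epsilon>" "\<epsilon> \<le> 1"
    and w: "\<And>K. K \<subseteq> cube_edges d \<Longrightarrow> \<bar>w K\<bar> \<le> 1" "w {} = 1"
  defines "S \<equiv> {K\<in>Pow (cube_edges d). cube_balanced d m P K}"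
  shows "\<bar>(\<Sum>K\<in>S. \<epsilon> ^ card K * w K) - 1\<bar> \<le> 2 ^ card (cube_edges d) * \<epsilon>"
    and "\<bar>(\<Sum>K\<in>S. \<epsilon> ^ card K * w K) - 1 - \<epsilon> ^ 4 *
      (\<Sum>(v, i, j)\<in>{(v, i, j)\<in>corners d. cube_balanced d m P (square d v i j)}. w (square d v i j)) / 8\<bar>
      \<le> 2 ^ card (cube_edges d) * \<epsilon> ^ 5"
proof -
  have finS: "finite S" unfolding S_def using finite_cube(3) by simp
  have empty: "{} \<in> S" by (simp add: S_def balanced_def)
  have split: "(\<Sum>K\<in>S. \<epsilon> ^ card K * w K) = 1 + (\<Sum>K\<in>S - {{}}. \<epsilon> ^ card K * w K)"
    using sum.remove[OF finS empty, of "\<lambda>K. \<epsilon> ^ card K * w K"] w(2) by simp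
  have "finite K" if "K \<in> S" for K
    using that finite_cube(3) finite_subset by (auto simp: S_def)
  then have pos: "1 \<le> card K" if "K \<in> S - {{}}" for K
    using that by (simp add: Suc_le_eq card_gt_0_iff)
  have "\<bar>\<Sum>K\<in>S - {{}}. \<epsilon> ^ card K * w K\<bar> \<le> 2 ^ card (cube_edges d) * \<epsilon> ^ 1"
    by (rule abs_balanced_sum_le[OF \<epsilon> w(1) _ pos]) (auto simp: S_def)
  then show "\<bar>(\<Sum>K\<in>S. \<epsilon> ^ card K * w K) - 1\<bar> \<le> 2 ^ card (cube_edges d) * \<epsilon>"
    unfolding split by simp
  let ?S4 = "{K\<in>Pow (cube_edges d). cube_balanced d m P K \<and> card K = 4}"
  let ?S5 = "{K\<in>S. 5 \<le> card K}"
  have "S - {{}} = ?S4 \<union> ?S5"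
  proof
    show "S - {{}} \<subseteq> ?S4 \<union> ?S5"
    proof
      fix K assume "K \<in> S - {{}}"
      then show "K \<in> ?S4 \<union> ?S5" using cube_balanced_cases[OF m, of K d P] by (auto simp: S_def)
    qed
    show "?S4 \<union> ?S5 \<subseteq> S - {{}}" by (auto simp: S_def)
  qed
  moreover have "finite ?S4" "finite ?S5" "?S4 \<inter> ?S5 = {}"
    using finite_cube(3) finS by auto
  ultimately have "(\<Sum>K\<in>S - {{}}. \<epsilon> ^ card K * w K)
      = (\<Sum>K\<in>?S4. \<epsilon> ^ card K * w K) + (\<Sum>K\<in>?S5. \<epsilon> ^ card K * w K)"
    by (simp only: sum.union_disjoint)
  also have "(\<Sum>K\<in>?S4. \<epsilon> ^ card K * w K) = \<epsilon> ^ 4 * (\<Sum>K\<in>?S4. w K)"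
    unfolding sum_distrib_left by (rule sum.cong) auto
  also have "(\<Sum>K\<in>?S4. w K) = (\<Sum>(v, i, j)\<in>{(v, i, j)\<in>corners d. cube_balanced d m P (square d v i j)}.
      w (square d v i j)) / 8"
    by (rule sum_squares[OF m])
  finally have "(\<Sum>K\<in>S - {{}}. \<epsilon> ^ card K * w K) = \<epsilon> ^ 4 * ((\<Sum>(v, i, j)\<in>{(v, i, j)\<in>corners d.
      cube_balanced d m P (square d v i j)}. w (square d v i j)) / 8) + (\<Sum>K\<in>?S5. \<epsilon> ^ card K * w K)" .
  moreover have "\<bar>\<Sum>K\<in>?S5. \<epsilon> ^ card K * w K\<bar> \<le> 2 ^ card (cube_edges d) * \<epsilon> ^ 5"
    by (rule abs_balanced_sum_le[OF \<epsilon> w(1)]) (auto simp: S_def)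
  ultimately show "\<bar>(\<Sum>K\<in>S. \<epsilon> ^ card K * w K) - 1 - \<epsilon> ^ 4 *
      (\<Sum>(v, i, j)\<in>{(v, i, j)\<in>corners d. cube_balanced d m P (square d v i j)}. w (square d v i j)) / 8\<bar>
      \<le> 2 ^ card (cube_edges d) * \<epsilon> ^ 5"
    unfolding split by simp
qed

section \<open>Alternating and monochromatic squares\<close>

definition bicoloured :: "nat \<Rightarrow> ((nat \<Rightarrow> nat) \<times> (nat \<Rightarrow> nat)) set \<Rightarrow> (nat \<Rightarrow> nat) \<Rightarrow> nat \<Rightarrow> nat \<Rightarrow> bool" where
  "bicoloured d P v i j \<longleftrightarrow> (cube_edge d v i \<in> P) \<noteq> (cube_edge d v j \<in> P)"

lemma cube_balanced_square_iff:
  assumes c: "(v, i, j) \<in> corners d"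
  shows "cube_balanced d m P (square d v i j) \<longleftrightarrow>
    (\<forall>x\<in>{v, flip i v, flip j v, flip i (flip j v)}.
      int m dvd sg (cube_edge d x i \<in> P) + sg (cube_edge d x j \<in> P))"
proof -
  let ?V = "{v, flip i v, flip j v, flip i (flip j v)}"
  have v: "v \<in> cube_verts d" "i < d" "j < d" "i \<noteq> j" using c by (auto simp: corners_def)
  then have V: "?V \<subseteq> cube_verts d" by (simp add: flip_in_cube_verts)
  have "(\<Sum>k\<in>{k. k < d \<and> cube_edge d x k \<in> square d v i j}. sg (cube_edge d x k \<in> P))
     = (if x \<in> ?V then sg (cube_edge d x i \<in> P) + sg (cube_edge d x j \<in> P) else 0)"
    if "x \<in> cube_verts d" for x
    unfolding square_edges_at[OF c that] using v(4) by simp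
  then have "cube_balanced d m P (square d v i j) \<longleftrightarrow> (\<forall>x\<in>cube_verts d.
     int m dvd (if x \<in> ?V then sg (cube_edge d x i \<in> P) + sg (cube_edge d x j \<in> P) else 0))"
    unfolding cube_balanced_iff[OF square_subset[OF c]] by (intro ball_cong refl) (simp only:)
  then show ?thesis using V by (auto simp del: insert_iff)
qed

lemma cube_balanced_square_two:
  "(v, i, j) \<in> corners d \<Longrightarrow> cube_balanced d 2 P (square d v i j)"
  unfolding cube_balanced_square_iff by (auto simp: sg_def)

text \<open>At each corner the two signs add up to -2, 0 or 2, and \<open>m \<ge> 3\<close> divides
  only 0. So the balanced squares are those whose colours alternate around the 4-cycle.\<close>

lemma cube_balanced_square_bicoloured:
  assumes "(v, i, j) \<in> corners d" "m \<ge> 3"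
  shows "cube_balanced d m P (square d v i j) \<longleftrightarrow>
    (\<forall>x\<in>{v, flip i v, flip j v, flip i (flip j v)}. bicoloured d P x i j)"
proof -
  have "int m dvd sg a + sg b \<longleftrightarrow> a \<noteq> b" for a b
    using assms(2) zdvd_not_zless[of 2 "int m"] by (auto simp: sg_def)
  then show ?thesis unfolding cube_balanced_square_iff[OF assms(1)] bicoloured_def by simp
qed

lemma square_edges_corner:
  assumes "(v, i, j) \<in> corners d"
  shows "cube_edge d (flip i v) i = cube_edge d v i"
    and "cube_edge d (flip j v) j = cube_edge d v j"
    and "cube_edge d (flip i (flip j v)) i = cube_edge d (flip j v) i"
    and "cube_edge d (flip i (flip j v)) j = cube_edge d (flip i v) j"
proof -
  have v: "v \<in> cube_verts d" "i < d" "j < d" using assms by (auto simp: corners_def)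
  have fv: "flip i v \<in> cube_verts d" "flip j v \<in> cube_verts d" using v by (simp_all add: flip_in_cube_verts)
  show "cube_edge d (flip i v) i = cube_edge d v i" by (rule cube_edge_flip[OF v(1,2)])
  show "cube_edge d (flip j v) j = cube_edge d v j" by (rule cube_edge_flip[OF v(1,3)])
  show "cube_edge d (flip i (flip j v)) i = cube_edge d (flip j v) i" by (rule cube_edge_flip[OF fv(2) v(2)])
  show "cube_edge d (flip i (flip j v)) j = cube_edge d (flip i v) j"
    unfolding flip_commute[of i j v] by (rule cube_edge_flip[OF fv(1) v(3)])
qed

lemma prod_square:
  fixes f :: "_ \<Rightarrow> 'c :: comm_monoid_mult"
  assumes "(v, i, j) \<in> corners d"
  shows "(\<Prod>e\<in>square d v i j. f e) = f (cube_edge d v i) * (f (cube_edge d v j) *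
    (f (cube_edge d (flip j v) i) * f (cube_edge d (flip i v) j)))"
  using square_distinct[OF assms] by (simp add: square_def)

text \<open>Two opposite edges lie in \<open>P\<close> and the other two do not, which gives
  \<open>z\<close> and \<open>cnj z\<close> twice each.\<close>

lemma square_weight_bicoloured:
  assumes "(v, i, j) \<in> corners d" "\<forall>x\<in>{v, flip i v, flip j v, flip i (flip j v)}. bicoloured d P x i j"
  shows "Re (\<Prod>e\<in>square d v i j. cj (e \<in> P) z) = cmod z ^ 4"
proof -
  have "(\<Prod>e\<in>square d v i j. cj (e \<in> P) z) = (z * cnj z) * (z * cnj z)"
    using assms(2) square_edges_corner[OF assms(1)] unfolding prod_square[OF assms(1)] bicoloured_def
    by (auto simp: cj_def)
  also have "\<dots> = of_real (cmod z ^ 4)"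
    by (simp only: complex_norm_square[symmetric] of_real_power[symmetric] of_real_mult[symmetric])
      (simp add: power2_eq_square[symmetric] power_mult[symmetric] mult_2_right[symmetric] flip: power_add)
  finally show ?thesis by simp
qed

text \<open>All four edges have one colour, so the product is \<open>z ^ 4\<close> or its conjugate,
  with the same real part.\<close>

lemma square_weight_monochromatic:
  assumes "(v, i, j) \<in> corners d" "\<forall>x\<in>{v, flip i v, flip j v, flip i (flip j v)}. \<not> bicoloured d P x i j"
  shows "Re (\<Prod>e\<in>square d v i j. cj (e \<in> P) z) = Re (z ^ 4)"
proof -
  have "(\<Prod>e\<in>square d v i j. cj (e \<in> P) z) = cj (cube_edge d v i \<in> P) (z ^ 4)"
    using assms(2) square_edges_corner[OF assms(1)] unfolding prod_square[OF assms(1)] bicoloured_def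
    by (auto simp: cj_def power4_eq_xxxx mult_ac)
  then show ?thesis by (simp add: cj_def del: complex_cnj_power flip: complex_cnj_power)
qed

section \<open>Counting corners by colour\<close>

lemma card_corners:
  "card {(v, i, j)\<in>corners d. Q v i j}
    = (\<Sum>v\<in>cube_verts d. card {(i, j). i < d \<and> j < d \<and> i \<noteq> j \<and> Q v i j})"
proof -
  have "{(v, i, j)\<in>corners d. Q v i j}
      = (SIGMA v:cube_verts d. {(i, j). i < d \<and> j < d \<and> i \<noteq> j \<and> Q v i j})"
    by (auto simp: corners_def)
  moreover have "finite {(i, j). i < d \<and> j < d \<and> i \<noteq> j \<and> Q v i j}" for v
    by (rule finite_subset[of _ "{..<d} \<times> {..<d}"]) auto
  ultimately show ?thesis by (simp add: card_SigmaI finite_cube_verts)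
qed

lemma card_colour_class:
  assumes "cube_balanced d (d + 1) P (cube_edges d)" "v \<in> cube_verts d"
  shows "2 * card {i. i < d \<and> cube_edge d v i \<in> P} = d"
proof -
  let ?I = "{i. i < d \<and> cube_edge d v i \<in> P}"
  have "{i. i < d \<and> cube_edge d v i \<in> cube_edges d} = {..<d}"
    using cube_edge_in[OF assms(2)] by auto
  then have dvd: "int (d + 1) dvd (\<Sum>i<d. sg (cube_edge d v i \<in> P))"
    using assms unfolding cube_balanced_iff[OF order_refl] by fastforce
  have "card ?I \<le> card {..<d}" by (rule card_mono) auto
  then have le: "card ?I \<le> d" by simp
  have "(\<Sum>i<d. sg (cube_edge d v i \<in> P)) = (\<Sum>i<d. 2 * (if cube_edge d v i \<in> P then 1 else 0) - 1)"
    by (rule sum.cong) (auto simp: sg_def)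
  also have "\<dots> = 2 * int (card ?I) - int d"
    by (simp add: sum_subtractf sum_distrib_left[symmetric] sum.If_cases Int_def)
  finally have eq: "(\<Sum>i<d. sg (cube_edge d v i \<in> P)) = 2 * int (card ?I) - int d" .
  \<comment> \<open>This number is a multiple of \<open>d + 1\<close> lying between
    \<open>- d\<close> and \<open>d\<close>. Here the choice of modulus \<open>d + 1\<close>
    matters.\<close>
  have "2 * int (card ?I) - int d = 0"
  proof (rule ccontr)
    assume "2 * int (card ?I) - int d \<noteq> 0"
    then have "\<bar>int (d + 1)\<bar> \<le> \<bar>2 * int (card ?I) - int d\<bar>"
      using dvd unfolding eq by (rule dvd_imp_le_int)
    then show False using le by linarith
  qed
  then show ?thesis by linarith
qed

text \<open>Every vertex has \<open>h\<close> edges of each colour, so the counts of ordered pairs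
  of directions are the same at each vertex and for each balanced \<open>P\<close>. The first count
  is thus a common upper bound for the alternating squares.\<close>

lemma card_bicoloured_corners:
  assumes P: "cube_balanced d (d + 1) P (cube_edges d)" and d: "d = 2 * h"
  shows "card {(v, i, j)\<in>corners d. bicoloured d P v i j} = card (cube_verts d) * (2 * h\<^sup>2)"
    and "card {(v, i, j)\<in>corners d. \<not> bicoloured d P v i j} = card (cube_verts d) * (2 * h * (h - 1))"
proof -
  have "card {(i, j). i < d \<and> j < d \<and> i \<noteq> j \<and> bicoloured d P v i j} = 2 * h\<^sup>2 \<and>
    card {(i, j). i < d \<and> j < d \<and> i \<noteq> j \<and> \<not> bicoloured d P v i j} = 2 * h * (h - 1)"
    if v: "v \<in> cube_verts d" for v
  proof -
    define I where "I = {i. i < d \<and> cube_edge d v i \<in> P}"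
    define J where "J = {i. i < d \<and> cube_edge d v i \<notin> P}"
    have fin: "finite I" "finite J" by (simp_all add: I_def J_def)
    have disj: "I \<inter> J = {}" "I \<union> J = {..<d}" by (auto simp: I_def J_def)
    have cI: "card I = h" using card_colour_class[OF P v] d by (simp add: I_def)
    have "card I + card J = d" using card_Un_disjoint[OF fin disj(1)] disj(2) by simp
    then have cJ: "card J = h" using cI d by simp
    have "{(i, j). i < d \<and> j < d \<and> i \<noteq> j \<and> bicoloured d P v i j} = I \<times> J \<union> J \<times> I"
      by (auto simp: I_def J_def bicoloured_def)
    moreover have "card (I \<times> J \<union> J \<times> I) = card (I \<times> J) + card (J \<times> I)"
      using fin disj by (intro card_Un_disjoint) auto
    ultimately have 1: "card {(i, j). i < d \<and> j < d \<and> i \<noteq> j \<and> bicoloured d P v i j} = 2 * h\<^sup>2"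
      by (simp add: card_cartesian_product cI cJ power2_eq_square)
    have offdiag: "card (X \<times> X - (\<lambda>x. (x, x)) ` X) = h * (h - 1)" if "finite X" "card X = h" for X :: "nat set"
    proof -
      have "card (X \<times> X - (\<lambda>x. (x, x)) ` X) = card (X \<times> X) - card ((\<lambda>x. (x, x)) ` X)"
        using that by (intro card_Diff_subset) auto
      also have "card ((\<lambda>x. (x, x)) ` X) = h"
        using that by (subst card_image) (auto simp: inj_on_def)
      finally show ?thesis using that by (simp add: card_cartesian_product diff_mult_distrib2)
    qed
    have "{(i, j). i < d \<and> j < d \<and> i \<noteq> j \<and> \<not> bicoloured d P v i j}
        = (I \<times> I - (\<lambda>x. (x, x)) ` I) \<union> (J \<times> J - (\<lambda>x. (x, x)) ` J)"
      by (auto simp: I_def J_def bicoloured_def)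
    moreover have "card ((I \<times> I - (\<lambda>x. (x, x)) ` I) \<union> (J \<times> J - (\<lambda>x. (x, x)) ` J))
        = card (I \<times> I - (\<lambda>x. (x, x)) ` I) + card (J \<times> J - (\<lambda>x. (x, x)) ` J)"
      using fin disj by (intro card_Un_disjoint) auto
    ultimately have "card {(i, j). i < d \<and> j < d \<and> i \<noteq> j \<and> \<not> bicoloured d P v i j} = 2 * h * (h - 1)"
      using offdiag[OF fin(1) cI] offdiag[OF fin(2) cJ] by simp
    with 1 show ?thesis by blast
  qed
  then show "card {(v, i, j)\<in>corners d. bicoloured d P v i j} = card (cube_verts d) * (2 * h\<^sup>2)"
    "card {(v, i, j)\<in>corners d. \<not> bicoloured d P v i j} = card (cube_verts d) * (2 * h * (h - 1))"
    unfolding card_corners by simp_all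
qed

text \<open>Squares are recorded with a corner and ordered directions, so each counts eight times;
  the divisor 8 in the expansions compensates.\<close>

definition alternating_squares where
  "alternating_squares d P = {(v, i, j)\<in>corners d. cube_balanced d (d + 1) P (square d v i j)}"

lemma alternating_squares_subset:
  assumes "d \<ge> 2"
  shows "alternating_squares d P \<subseteq> {(v, i, j)\<in>corners d. bicoloured d P v i j}"
  using cube_balanced_square_bicoloured[of _ _ _ d "d + 1" P] assms
  by (auto simp: alternating_squares_def)

text \<open>Colour an edge by whether its direction is below \<open>h\<close>. Whether a corner is
  bicoloured then depends only on its two directions, so all corners of a square agree and the upper
  bound on alternating squares is attained.\<close>

lemma direction_colouring:
  assumes d: "d = 2 * h" "h \<ge> 1"
  shows "\<exists>P\<subseteq>cube_edges d. cube_balanced d (d + 1) P (cube_edges d) \<and>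
    card (alternating_squares d P) = card (cube_verts d) * (2 * h\<^sup>2)"
proof (intro exI conjI)
  let ?P = "{cube_edge d v i | v i. v \<in> cube_verts d \<and> i < h}"
  show sub: "?P \<subseteq> cube_edges d" using d by (auto intro!: cube_edge_in)
  have mem: "cube_edge d x k \<in> ?P \<longleftrightarrow> k < h" if "x \<in> cube_verts d" "k < d" for x k
  proof
    assume "cube_edge d x k \<in> ?P"
    then obtain v i where "cube_edge d x k = cube_edge d v i" "v \<in> cube_verts d" "i < h" by blast
    then show "k < h" using cube_edge_eq_iff[OF that, of v i] d by simp
  qed (use that in blast)
  show bal: "cube_balanced d (d + 1) ?P (cube_edges d)"
    unfolding cube_balanced_iff[OF order_refl]
  proof
    fix v assume v: "v \<in> cube_verts d"
    have "(\<Sum>i\<in>{i. i < d \<and> cube_edge d v i \<in> cube_edges d}. sg (cube_edge d v i \<in> ?P)) = (\<Sum>i<d. sg (i < h))"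
      using v cube_edge_in mem by (intro sum.cong) auto
    also have "\<dots> = (\<Sum>i<h. sg (i < h)) + (\<Sum>i=h..<d. sg (i < h))"
      using d by (subst sum.atLeastLessThan_concat[of 0 h d, symmetric, folded lessThan_atLeast0]) auto
    also have "\<dots> = 0" using d by (simp add: sg_def)
    finally show "int (d + 1) dvd (\<Sum>i\<in>{i. i < d \<and> cube_edge d v i \<in> cube_edges d}. sg (cube_edge d v i \<in> ?P))"
      by simp
  qed
  have "alternating_squares d ?P = {(v, i, j)\<in>corners d. bicoloured d ?P v i j}"
  proof
    show "alternating_squares d ?P \<subseteq> {(v, i, j)\<in>corners d. bicoloured d ?P v i j}"
      using d by (intro alternating_squares_subset) simp
    show "{(v, i, j)\<in>corners d. bicoloured d ?P v i j} \<subseteq> alternating_squares d ?P"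
    proof (clarify)
      fix v i j assume c: "(v, i, j) \<in> corners d" and b: "bicoloured d ?P v i j"
      have v: "v \<in> cube_verts d" "i < d" "j < d" using c by (auto simp: corners_def)
      have "{v, flip i v, flip j v, flip i (flip j v)} \<subseteq> cube_verts d"
        using v by (simp add: flip_in_cube_verts)
      moreover have "bicoloured d ?P x i j \<longleftrightarrow> (i < h) \<noteq> (j < h)" if "x \<in> cube_verts d" for x
        unfolding bicoloured_def mem[OF that v(2)] mem[OF that v(3)] ..
      ultimately have "\<forall>x\<in>{v, flip i v, flip j v, flip i (flip j v)}. bicoloured d ?P x i j"
        using b v(1) by blast
      then show "(v, i, j) \<in> alternating_squares d ?P"
        using cube_balanced_square_bicoloured[OF c, of "d + 1" ?P] c d by (simp add: alternating_squares_def)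
    qed
  qed
  then show "card (alternating_squares d ?P) = card (cube_verts d) * (2 * h\<^sup>2)"
    using card_bicoloured_corners(1)[OF bal d(1)] by simp
qed

text \<open>When the upper bound is attained, every bicoloured corner belongs to an alternating
  square, so all other squares are monochromatic. The two kinds have weights
  \<open>cmod z ^ 4\<close> and \<open>Re (z ^ 4)\<close>, and their numbers are known.\<close>

lemma sum_square_weights:
  assumes P: "cube_balanced d (d + 1) P (cube_edges d)" and d: "d = 2 * h" "h \<ge> 1"
    and max: "card (alternating_squares d P) \<ge> card (cube_verts d) * (2 * h\<^sup>2)"
  shows "(\<Sum>(v, i, j)\<in>{(v, i, j)\<in>corners d. cube_balanced d 2 P (square d v i j)}.
      Re (\<Prod>e\<in>square d v i j. cj (e \<in> P) z))
    = real (card (cube_verts d)) * (2 * (real h)\<^sup>2 * cmod z ^ 4 + 2 * real h * (real h - 1) * Re (z ^ 4))"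
proof -
  let ?B = "{(v, i, j)\<in>corners d. bicoloured d P v i j}"
  let ?M = "{(v, i, j)\<in>corners d. \<not> bicoloured d P v i j}"
  let ?w = "\<lambda>(v, i, j). Re (\<Prod>e\<in>square d v i j. cj (e \<in> P) z)"
  have fin: "finite ?B" "finite ?M" by (rule finite_subset[OF _ finite_corners], auto)+
  have alt: "alternating_squares d P = ?B"
    using card_seteq[OF fin(1) alternating_squares_subset] max card_bicoloured_corners(1)[OF P d(1)] d
    by simp
  have B: "?w t = cmod z ^ 4" if t: "t \<in> ?B" for t
  proof -
    obtain v i j where tv: "t = (v, i, j)" by (cases t)
    then have c: "(v, i, j) \<in> corners d" using t by simp
    have "t \<in> alternating_squares d P" using t alt by blast
    then have "cube_balanced d (d + 1) P (square d v i j)" by (simp add: alternating_squares_def tv)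
    then show ?thesis
      using cube_balanced_square_bicoloured[OF c, of "d + 1" P] square_weight_bicoloured[OF c, of P z] d
      by (simp add: tv)
  qed
  have M: "?w t = Re (z ^ 4)" if t: "t \<in> ?M" for t
  proof -
    obtain v i j where tv: "t = (v, i, j)" by (cases t)
    then have c: "(v, i, j) \<in> corners d" and nb: "\<not> bicoloured d P v i j" using t by auto
    have v: "v \<in> cube_verts d" "i < d" "j < d" "i \<noteq> j" using c by (auto simp: corners_def)
    have fv: "flip i v \<in> cube_verts d" "flip j v \<in> cube_verts d" "flip i (flip j v) \<in> cube_verts d"
      using v by (simp_all add: flip_in_cube_verts)
    \<comment> \<open>A bicoloured corner anywhere on the square would make the whole square
      alternating, contrary to \<open>nb\<close>.\<close>
    have "\<not> bicoloured d P x i j" if x: "x \<in> {v, flip i v, flip j v, flip i (flip j v)}" for x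
    proof
      assume b: "bicoloured d P x i j"
      have "square d (flip i v) i j = square d v i j" "square d (flip j v) i j = square d v i j"
        "square d (flip i (flip j v)) i j = square d (flip j v) i j"
        using square_flip[OF v(1,2,3)] square_flip[OF v(1,3,2)] square_flip[OF fv(2) v(2,3)]
          square_swap[of d _ i j] by simp_all
      then have sq: "x \<in> cube_verts d \<and> square d x i j = square d v i j"
        using x v(1) fv by (elim insertE) simp_all
      then have "(x, i, j) \<in> ?B" using b v by (simp add: corners_def)
      then have "(x, i, j) \<in> alternating_squares d P" using alt by blast
      then have "(v, i, j) \<in> alternating_squares d P" using sq c by (simp add: alternating_squares_def)
      then show False using alt nb by blast
    qed
    then show ?thesis using square_weight_monochromatic[OF c, of P z] by (simp add: tv)
  qed
  have "{(v, i, j)\<in>corners d. cube_balanced d 2 P (square d v i j)} = ?B \<union> ?M"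
    by (auto simp: cube_balanced_square_two)
  moreover have "sum ?w (?B \<union> ?M) = sum ?w ?B + sum ?w ?M"
    by (rule sum.union_disjoint[OF fin]) auto
  moreover have "sum ?w ?B = real (card ?B) * cmod z ^ 4" "sum ?w ?M = real (card ?M) * Re (z ^ 4)"
    using B M by (simp_all only: sum_constant sum.cong)
  ultimately have "sum ?w {(v, i, j)\<in>corners d. cube_balanced d 2 P (square d v i j)}
     = real (card ?B) * cmod z ^ 4 + real (card ?M) * Re (z ^ 4)" by simp
  then show ?thesis
    unfolding card_bicoloured_corners[OF P d(1)] of_nat_mult of_nat_power of_nat_numeral of_nat_diff[OF d(2)]
    by (simp add: algebra_simps)
qed

text \<open>After division by the \<open>k\<close>-th power of the maximum of \<open>l\<close>, only
  the maximisers survive as \<open>k\<close> grows, and on them \<open>D\<close> is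
  positive.\<close>

lemma power_weighted_sum_pos:
  fixes l D :: "'a \<Rightarrow> real"
  assumes fin: "finite S" "S \<noteq> {}" and l: "\<And>x. x \<in> S \<Longrightarrow> l x > 0"
    and D: "\<And>x. x \<in> S \<Longrightarrow> (\<And>y. y \<in> S \<Longrightarrow> l y \<le> l x) \<Longrightarrow> D x > 0"
  shows "\<exists>k. (\<Sum>x\<in>S. l x ^ k * D x) > 0"
proof -
  define M where "M = Max (l ` S)"
  have M: "l x \<le> M" if "x \<in> S" for x using that fin by (simp add: M_def)
  have "M \<in> l ` S" using fin by (simp add: M_def)
  then obtain x0 where x0: "x0 \<in> S" "l x0 = M" by auto
  then have Mpos: "M > 0" using l by blast
  have "(\<lambda>k. \<Sum>x\<in>S. (l x / M) ^ k * D x) \<longlonglongrightarrow> (\<Sum>x\<in>S. (if l x = M then D x else 0))"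
  proof (rule tendsto_sum)
    fix x assume x: "x \<in> S"
    show "(\<lambda>k. (l x / M) ^ k * D x) \<longlonglongrightarrow> (if l x = M then D x else 0)"
    proof (cases "l x = M")
      case True
      then show ?thesis using Mpos by simp
    next
      case False
      then have "l x / M < 1" "0 \<le> l x / M" using M[OF x] l[OF x] Mpos by auto
      then have "(\<lambda>k. (l x / M) ^ k * D x) \<longlonglongrightarrow> 0 * D x"
        by (intro tendsto_mult tendsto_const LIMSEQ_realpow_zero)
      then show ?thesis using False by simp
    qed
  qed
  moreover have "(\<Sum>x\<in>S. (if l x = M then D x else 0)) > 0"
  proof (rule sum_pos2[OF fin(1) x0(1)])
    have max: "D x > 0" if "x \<in> S" "l x = M" for x using D[OF that(1)] that(2) M by simp
    then show "0 < (if l x0 = M then D x0 else 0)" using x0 by simp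
    show "0 \<le> (if l x = M then D x else 0)" if "x \<in> S" for x using max that by (simp add: less_imp_le)
  qed
  ultimately have "\<forall>\<^sub>F k in sequentially. (\<Sum>x\<in>S. (l x / M) ^ k * D x) > 0"
    by (rule order_tendstoD(1))
  then obtain k where k: "(\<Sum>x\<in>S. (l x / M) ^ k * D x) > 0"
    by (meson eventually_sequentially order_refl)
  have "(\<Sum>x\<in>S. l x ^ k * D x) = M ^ k * (\<Sum>x\<in>S. (l x / M) ^ k * D x)"
    using Mpos by (simp add: sum_distrib_left power_divide)
  then show ?thesis using k Mpos by (intro exI[of _ k]) simp
qed

section \<open>The test matrix\<close>

lemma Re_of_real_mult_sum:
  "Re (of_real a * (\<Sum>x\<in>S. of_real (f x) * g x)) = a * (\<Sum>x\<in>S. f x * Re (g x))"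
  by (simp add: sum_distrib_left)

text \<open>
  The factor with constant term 0 picks out \<open>K = E\<close> in the expansion of its coloured sum, since \<open>0 ^ card (E - K)\<close> is
  1 exactly for \<open>K = E\<close>.
\<close>
lemma hom_sum_cube_test_matrix:
  fixes d :: nat and L :: "nat \<Rightarrow> nat \<Rightarrow> complex" and \<epsilon> :: real and z :: complex
  defines "E \<equiv> cube_edges d"
  defines "N \<equiv> card (cube_even d) + card (cube_odd d)"
  assumes L: "\<And>P. colour_sum (cube_even d) (cube_odd d) E {..<n} P L
    = colour_sum (cube_even d) (cube_odd d) E {..<d + 1} P (char_matrix (d + 1) 1 \<epsilon>) ^ k"
  shows "hom_sum (cube_even d) (cube_odd d) E (({..<d + 1} \<times> {..<2}) \<times> {..<n})
      (\<lambda>x y. Re (char_matrix (d + 1) 0 1 (fst (fst x)) (fst (fst y)) *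
        char_matrix 2 1 (\<epsilon> * z) (snd (fst x)) (snd (fst y)) * L (snd x) (snd y)))
    = (1 / 2) ^ card E * real (d + 1) ^ N * 2 ^ N * (real (d + 1) ^ N) ^ k *
      (\<Sum>P\<in>{P\<in>Pow E. cube_balanced d (d + 1) P E}.
        (\<Sum>K\<in>{K\<in>Pow E. cube_balanced d (d + 1) P K}. \<epsilon> ^ card K) ^ k *
        (\<Sum>K\<in>{K\<in>Pow E. cube_balanced d 2 P K}. \<epsilon> ^ card K * Re (\<Prod>e\<in>K. cj (e \<in> P) z)))"
    (is "?H = ?C * (\<Sum>P\<in>?B. ?l P ^ k * ?p P)")
proof -
  let ?A = "cube_even d" and ?B' = "cube_odd d"
  note fin = finite_cube(1,2)[of d]
  have sub: "E \<subseteq> ?A \<times> ?B'" unfolding E_def by (rule cube_edges_subset)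
  have finE: "finite E" unfolding E_def by (rule finite_cube)
  let ?q = "\<lambda>P. \<Sum>K\<in>{K\<in>Pow E. cube_balanced d 2 P K}. of_real (\<epsilon> ^ card K) * (\<Prod>e\<in>K. cj (e \<in> P) z)"
  have cj_eps: "(\<Prod>e\<in>K. cj (e \<in> P) (of_real \<epsilon> * w)) = of_real (\<epsilon> ^ card K) * (\<Prod>e\<in>K. cj (e \<in> P) w)" for K P w
    by (simp add: cj_mult prod.distrib)
  have \<Omega>: "colour_sum ?A ?B' E {..<d + 1} P (char_matrix (d + 1) 0 1)
      = of_real (real (d + 1) ^ N) * (if cube_balanced d (d + 1) P E then 1 else 0)" for P
  proof -
    have "(\<Sum>K\<in>{K\<in>Pow E. cube_balanced d (d + 1) P K}. of_real 0 ^ card (E - K) * (\<Prod>e\<in>K. cj (e \<in> P) 1))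
       = (\<Sum>K\<in>{K\<in>Pow E. cube_balanced d (d + 1) P K}. if K = E then 1 else (0 :: complex))"
      using finE by (intro sum.cong refl) (auto simp: power_0_left card_eq_0_iff)
    also have "\<dots> = (if cube_balanced d (d + 1) P E then 1 else 0)"
      using finE by (simp add: sum.delta)
    finally show ?thesis
      unfolding N_def by (subst colour_sum_char_matrix[OF fin sub]) simp_all
  qed
  have F: "colour_sum ?A ?B' E {..<2} P (char_matrix 2 1 (of_real \<epsilon> * z)) = of_real (2 ^ N) * ?q P" for P
    unfolding N_def by (subst colour_sum_char_matrix[OF fin sub]) (simp_all only: cj_eps, simp_all)
  have Lp: "colour_sum ?A ?B' E {..<n} P L = of_real ((real (d + 1) ^ N) ^ k * ?l P ^ k)" for P
  proof -
    \<comment> \<open>The factor 1 is written out so that \<open>cj_eps\<close> applies.\<close>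
    have "colour_sum ?A ?B' E {..<d + 1} P (char_matrix (d + 1) 1 (of_real \<epsilon> * 1)) = of_real (real (d + 1) ^ N * ?l P)"
      unfolding N_def by (subst colour_sum_char_matrix[OF fin sub]) (simp_all only: cj_eps, simp_all)
    then show ?thesis unfolding L by (simp add: power_mult_distrib)
  qed
  have "complex_of_real ?H = (1 / 2) ^ card E * (\<Sum>P\<in>Pow E.
      colour_sum ?A ?B' E {..<d + 1} P (char_matrix (d + 1) 0 1) *
      colour_sum ?A ?B' E {..<2} P (char_matrix 2 1 (of_real \<epsilon> * z)) * colour_sum ?A ?B' E {..<n} P L)"
    by (simp only: hom_sum_Re[OF finE]
      colour_sum_tensor[OF sub, of "{..<d + 1} \<times> {..<2}" "{..<n}" _
        "\<lambda>x y. char_matrix (d + 1) 0 1 (fst x) (fst y) * char_matrix 2 1 (of_real \<epsilon> * z) (snd x) (snd y)" L]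
      colour_sum_tensor[OF sub, of "{..<d + 1}" "{..<2}"])
  also have "(\<Sum>P\<in>Pow E.
      colour_sum ?A ?B' E {..<d + 1} P (char_matrix (d + 1) 0 1) *
      colour_sum ?A ?B' E {..<2} P (char_matrix 2 1 (of_real \<epsilon> * z)) * colour_sum ?A ?B' E {..<n} P L)
    = (\<Sum>P\<in>Pow E. if cube_balanced d (d + 1) P E
        then of_real (real (d + 1) ^ N * 2 ^ N * (real (d + 1) ^ N) ^ k) * (of_real (?l P ^ k) * ?q P) else 0)"
    unfolding \<Omega> F Lp by (intro sum.cong refl) simp
  also have "\<dots> = (\<Sum>P\<in>?B. of_real (real (d + 1) ^ N * 2 ^ N * (real (d + 1) ^ N) ^ k) * (of_real (?l P ^ k) * ?q P))"
    using finE by (intro sum.inter_filter[symmetric]) simp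
  also have "\<dots> = of_real (real (d + 1) ^ N * 2 ^ N * (real (d + 1) ^ N) ^ k) * (\<Sum>P\<in>?B. of_real (?l P ^ k) * ?q P)"
    by (rule sum_distrib_left[symmetric])
  finally have "complex_of_real ?H = of_real ?C * (\<Sum>P\<in>?B. of_real (?l P ^ k) * ?q P)"
    by (simp add: mult.assoc)
  then have "?H = Re (of_real ?C * (\<Sum>P\<in>?B. of_real (?l P ^ k) * ?q P))" by (metis Re_complex_of_real)
  also have "\<dots> = ?C * (\<Sum>P\<in>?B. ?l P ^ k * Re (?q P))" by (rule Re_of_real_mult_sum)
  also have "(\<Sum>P\<in>?B. ?l P ^ k * Re (?q P)) = (\<Sum>P\<in>?B. ?l P ^ k * ?p P)" by simp
  finally show ?thesis .
qed

text \<open>The sign matrix vanishes nowhere, but each vertex contributes \<open>-1\<close> to an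
  odd power when its index is 1, so the sum over that index cancels. In terms of balanced sets,
  \<open>E\<close> has odd degrees and is not balanced modulo 2.\<close>

lemma not_norming_odd_cube:
  assumes "odd d"
  shows "\<not> norming (cube_even d) (cube_odd d) (cube_edges d)"
proof
  assume N: "norming (cube_even d) (cube_odd d) (cube_edges d)"
  let ?A = "cube_even d" and ?B = "cube_odd d" and ?E = "cube_edges d"
  define W :: "nat \<Rightarrow> nat \<Rightarrow> real" where "W x y = (-1) ^ (x + y)" for x y
  have char: "char_matrix 2 0 1 = (\<lambda>x y. of_real (W x y))"
  proof (intro ext)
    fix x y :: nat
    have "char_matrix 2 0 1 x y = cis (real (x + y) * pi)" by (simp add: char_matrix_def mult.commute)
    also have "\<dots> = cis pi ^ (x + y)" by (rule Complex.DeMoivre[symmetric])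
    finally show "char_matrix 2 0 1 x y = of_real (W x y)" by (simp add: W_def)
  qed
  define v :: "nat \<Rightarrow> nat" where "v = (\<lambda>i\<in>{..<d}. 0)"
  have v: "v \<in> cube_verts d" by (auto simp: v_def cube_verts_def)
  \<comment> \<open>With constant term 0 only \<open>K = E\<close> could contribute. As the matrix
    is real any colouring would do; \<open>P = E\<close> is taken.\<close>
  have "\<not> cube_balanced d 2 ?E ?E"
  proof
    assume "cube_balanced d 2 ?E ?E"
    then have "int 2 dvd (\<Sum>i\<in>{i. i < d \<and> cube_edge d v i \<in> ?E}. sg (cube_edge d v i \<in> ?E))"
      using v unfolding cube_balanced_iff[OF order_refl] by blast
    also have "(\<Sum>i\<in>{i. i < d \<and> cube_edge d v i \<in> ?E}. sg (cube_edge d v i \<in> ?E)) = (\<Sum>i<d. 1)"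
      using cube_edge_in[OF v] by (intro sum.cong) (auto simp: sg_def)
    finally show False using assms by simp
  qed
  then have "colour_sum ?A ?B ?E {..<2} ?E (char_matrix 2 0 1) = 0"
    using finite_cube[of d] by (subst colour_sum_char_matrix[OF finite_cube(1,2) cube_edges_subset])
      (auto intro!: sum.neutral simp: power_0_left card_eq_0_iff)
  then have "hom_sum ?A ?B ?E {..<2} W = 0"
    unfolding char colour_sum_of_real by simp
  moreover have "hom_sum ?A ?B ?E {..<2} W \<noteq> 0"
    by (rule norming_hom_sum_nonzero[OF N finite_cube(1,2) cube_edges_subset]) (simp_all add: W_def)
  ultimately show False by simp
qed

text \<open>The test matrix at \<open>Re z\<close> is, in real parts, the average of those at
  \<open>z\<close> and \<open>cnj z\<close>, and the latter two have equal sums. The triangle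
  inequality then says that replacing \<open>z\<close> by \<open>Re z\<close> cannot increase the
  norm.\<close>

lemma norming_test_matrix_le:
  fixes z :: complex and \<epsilon> :: real
  assumes N: "norming (cube_even d) (cube_odd d) (cube_edges d)" and d: "d > 0"
  defines "E \<equiv> cube_edges d"
  defines "S \<equiv> \<lambda>z k. \<Sum>P\<in>{P\<in>Pow E. cube_balanced d (d + 1) P E}.
        (\<Sum>K\<in>{K\<in>Pow E. cube_balanced d (d + 1) P K}. \<epsilon> ^ card K) ^ k *
        (\<Sum>K\<in>{K\<in>Pow E. cube_balanced d 2 P K}. \<epsilon> ^ card K * Re (\<Prod>e\<in>K. cj (e \<in> P) z))"
  shows "\<bar>S (of_real (Re z)) k\<bar> \<le> \<bar>S z k\<bar>"
proof -
  let ?A = "cube_even d" and ?B = "cube_odd d"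
  note fin = finite_cube(1,2)[of d]
  have sub: "E \<subseteq> ?A \<times> ?B" unfolding E_def by (rule cube_edges_subset)
  have finE: "finite E" unfolding E_def by (rule finite_cube)
  have "(\<lambda>i\<in>{..<d}. 0) \<in> cube_verts d" by (auto simp: cube_verts_def)
  then have "E \<noteq> {}" using cube_edge_in[of _ d 0] d by (auto simp: E_def)
  then have e: "card E > 0" using finE by (simp add: card_gt_0_iff)
  obtain n and L :: "nat \<Rightarrow> nat \<Rightarrow> complex" where n: "n > 0" and L: "\<And>P. colour_sum ?A ?B E {..<n} P L
      = colour_sum ?A ?B E {..<d + 1} P (char_matrix (d + 1) 1 \<epsilon>) ^ k"
    using colour_sum_power[OF sub, of "d + 1" "char_matrix (d + 1) 1 \<epsilon>" k] by auto
  let ?I = "({..<d + 1} \<times> {..<2 :: nat}) \<times> {..<n}"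
  define M where "M z x y = char_matrix (d + 1) 0 1 (fst (fst x)) (fst (fst y)) *
        char_matrix 2 1 (\<epsilon> * z) (snd (fst x)) (snd (fst y)) * L (snd x) (snd y)"
    for z :: complex and x y :: "(nat \<times> nat) \<times> nat"
  define T where "T z = hom_sum ?A ?B E ?I (\<lambda>x y. Re (M z x y))" for z
  \<comment> \<open>The factor between \<open>T\<close> and \<open>S\<close> is positive and
    independent of \<open>z\<close>, so it drops out of the comparison.\<close>
  obtain C where C: "C > 0" and T: "\<And>z. T z = C * S z k"
  proof
    let ?N = "card (cube_even d) + card (cube_odd d)"
    show "(1 / 2) ^ card E * real (d + 1) ^ ?N * 2 ^ ?N * (real (d + 1) ^ ?N) ^ k > 0" by simp
    show "T z = (1 / 2) ^ card E * real (d + 1) ^ ?N * 2 ^ ?N * (real (d + 1) ^ ?N) ^ k * S z k" for z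
      unfolding T_def M_def S_def E_def by (rule hom_sum_cube_test_matrix[OF L[unfolded E_def]])
  qed
  have S_cnj: "S (cnj z) k = S z k"
  proof -
    have "Re (\<Prod>e\<in>K. cj (e \<in> P) (cnj z)) = Re (\<Prod>e\<in>K. cj (e \<in> P) z)"
      for K P :: "((nat \<Rightarrow> nat) \<times> (nat \<Rightarrow> nat)) set"
    proof -
      have "(\<Prod>e\<in>K. cj (e \<in> P) (cnj z)) = cnj (\<Prod>e\<in>K. cj (e \<in> P) z)"
        by (auto simp: cj_def intro!: prod.cong)
      then show ?thesis by (simp only: cnj.sel)
    qed
    then show ?thesis unfolding S_def by (simp only:)
  qed
  \<comment> \<open>Only the second factor of \<open>M\<close> involves \<open>z\<close>, and it
    does so affinely.\<close>
  have avg: "2 * Re (M (of_real (Re z)) x y) = Re (M z x y) + Re (M (cnj z) x y)" for x y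
  proof -
    have "2 * M (of_real (Re z)) x y = M z x y + M (cnj z) x y"
      unfolding M_def char_matrix_def
      by (simp add: complex_add_cnj[symmetric] algebra_simps flip: of_real_mult) (simp add: complex_eq_iff algebra_simps)
    then show ?thesis by (metis Re_complex_of_real complex_add_cnj mult_2 plus_complex.simps(1))
  qed
  have I: "finite ?I" by simp
  have I': "?I \<noteq> {}" using n by (simp add: lessThan_empty_iff)
  have "\<bar>2 ^ card E * T (of_real (Re z))\<bar> powr (1 / card E)
      = \<bar>hom_sum ?A ?B E ?I (\<lambda>x y. Re (M z x y) + Re (M (cnj z) x y))\<bar> powr (1 / card E)"
    unfolding T_def hom_sum_cmult[symmetric] avg ..
  also have "\<dots> \<le> \<bar>T z\<bar> powr (1 / card E) + \<bar>T (cnj z)\<bar> powr (1 / card E)"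
    unfolding T_def by (rule norming_hom_sum_triangle[OF N[folded E_def] fin sub I I'])
  also have "\<dots> = 2 * \<bar>T z\<bar> powr (1 / card E)" by (simp add: T S_cnj)
  also have "\<bar>2 ^ card E * T (of_real (Re z))\<bar> powr (1 / card E)
      = 2 * \<bar>T (of_real (Re z))\<bar> powr (1 / card E)"
  proof -
    have "(2 ^ card E) powr (1 / card E) = (2 powr card E) powr (1 / card E)"
      by (simp add: powr_realpow)
    also have "\<dots> = 2" using e by (simp add: powr_powr)
    finally show ?thesis by (simp add: abs_mult powr_mult)
  qed
  finally have le: "\<bar>T (of_real (Re z))\<bar> powr (1 / card E) \<le> \<bar>T z\<bar> powr (1 / card E)" by simp
  have "\<bar>T (of_real (Re z))\<bar> \<le> \<bar>T z\<bar>"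
  proof (rule ccontr)
    assume "\<not> ?thesis"
    then have "\<bar>T z\<bar> powr (1 / card E) < \<bar>T (of_real (Re z))\<bar> powr (1 / card E)"
      using e by (intro powr_less_mono2) auto
    with le show False by simp
  qed
  then show ?thesis using C by (simp add: T abs_mult)
qed

text \<open>A norm would bound the weighted sum at \<open>Re z\<close> by that at \<open>z\<close>
  for every exponent \<open>k\<close>. For some large \<open>k\<close> the colourings with most
  alternating squares dominate, and for these the coefficient of \<open>\<epsilon> ^ 4\<close> is
  larger at \<open>Re z\<close>.\<close>

lemma not_norming_even_cube:
  assumes d: "d = 2 * h" and h: "h \<ge> 2"
  shows "\<not> norming (cube_even d) (cube_odd d) (cube_edges d)"
proof
  assume N: "norming (cube_even d) (cube_odd d) (cube_edges d)"
  define E where "E = cube_edges d"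
  \<comment> \<open>Chosen to make \<open>R = 1 / 100\<close>: this bounds the distance of
    \<open>l\<close> and \<open>p\<close> from 1, and also the error in their coefficients of
    \<open>\<epsilon> ^ 4\<close>.\<close>
  define \<epsilon> :: real where "\<epsilon> = 1 / (100 * 2 ^ card E)"
  define R where "R = (2 :: real) ^ card E * \<epsilon>"
  have \<epsilon>: "0 < \<epsilon>" "\<epsilon> \<le> 1" and R: "R = 1 / 100"
  proof -
    have "(1 :: real) \<le> 2 ^ card E" by simp
    then have "(1 :: real) \<le> 2 ^ card E * 100" by linarith
    then show "0 < \<epsilon>" "\<epsilon> \<le> 1" "R = 1 / 100" by (simp_all add: \<epsilon>_def R_def field_simps)
  qed
  define B where "B = {P\<in>Pow E. cube_balanced d (d + 1) P E}"
  define l where "l P = (\<Sum>K\<in>{K\<in>Pow E. cube_balanced d (d + 1) P K}. \<epsilon> ^ card K)" for P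
  define p where "p z P = (\<Sum>K\<in>{K\<in>Pow E. cube_balanced d 2 P K}. \<epsilon> ^ card K * Re (\<Prod>e\<in>K. cj (e \<in> P) z))" for z P
  \<comment> \<open>A rational point of the unit circle close enough to an eighth root of unity for
    \<open>Re (z ^ 4)\<close> to be clearly negative.\<close>
  define z where "z = Complex (4 / 5) (3 / 5)"
  define Q where "Q = card (cube_verts d) * (2 * h\<^sup>2)"
  have finB: "finite B" using finite_cube(3) by (simp add: B_def E_def)
  have z: "cmod z = 1" "Re z = 4 / 5" "Re (z ^ 4) = - 527 / 625"
    by (simp_all add: z_def cmod_def power4_eq_xxxx) (simp add: power2_eq_square)
  have V: "real (card (cube_verts d)) \<ge> 1"
  proof -
    have "(\<lambda>i\<in>{..<d}. 0) \<in> cube_verts d" by (auto simp: cube_verts_def)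
    then have "card (cube_verts d) > 0" using finite_cube_verts card_gt_0_iff by blast
    then show ?thesis by simp
  qed
  have l_exp: "\<bar>l P - 1\<bar> \<le> R" "\<bar>l P - 1 - \<epsilon> ^ 4 * real (card (alternating_squares d P)) / 8\<bar> \<le> R * \<epsilon> ^ 4" for P
    using cube_balanced_expansion[of "d + 1" \<epsilon> d "\<lambda>_. 1" P] \<epsilon> d h
    by (simp_all add: l_def E_def R_def alternating_squares_def case_prod_beta power_Suc[of \<epsilon> 4, simplified] mult_ac)
  have p_exp: "\<bar>p w P - 1\<bar> \<le> R" "\<bar>p w P - 1 - \<epsilon> ^ 4 * (\<Sum>(v, i, j)\<in>{(v, i, j)\<in>corners d. cube_balanced d 2 P (square d v i j)}.
      Re (\<Prod>e\<in>square d v i j. cj (e \<in> P) w)) / 8\<bar> \<le> R * \<epsilon> ^ 4" if w: "cmod w \<le> 1" for w P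
  proof -
    have "\<bar>Re (\<Prod>e\<in>K. cj (e \<in> P) w)\<bar> \<le> 1" for K
    proof -
      have "\<bar>Re (\<Prod>e\<in>K. cj (e \<in> P) w)\<bar> \<le> cmod (\<Prod>e\<in>K. cj (e \<in> P) w)" by (rule abs_Re_le_cmod)
      also have "\<dots> = (\<Prod>e\<in>K. cmod w)"
        by (simp add: prod_norm[symmetric] cj_def if_distrib cong: if_cong)
      also have "\<dots> \<le> 1" using w by (simp add: power_le_one)
      finally show ?thesis .
    qed
    note * = cube_balanced_expansion[of 2 \<epsilon> d "\<lambda>K. Re (\<Prod>e\<in>K. cj (e \<in> P) w)" P, OF _ _ _ this]
    show "\<bar>p w P - 1\<bar> \<le> R" using *(1) \<epsilon> by (simp add: p_def E_def R_def)
    show "\<bar>p w P - 1 - \<epsilon> ^ 4 * (\<Sum>(v, i, j)\<in>{(v, i, j)\<in>corners d. cube_balanced d 2 P (square d v i j)}.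
      Re (\<Prod>e\<in>square d v i j. cj (e \<in> P) w)) / 8\<bar> \<le> R * \<epsilon> ^ 4"
      using *(2) \<epsilon> by (simp add: p_def E_def R_def power_Suc[of \<epsilon> 4, simplified] mult_ac)
  qed
  obtain P0 where P0: "P0 \<in> B" "card (alternating_squares d P0) = Q"
    using direction_colouring[OF d] h by (auto simp: B_def E_def Q_def)
  have "\<exists>k. (\<Sum>P\<in>B. l P ^ k * (p (of_real (Re z)) P - p z P)) > 0"
  proof (rule power_weighted_sum_pos[OF finB])
    show "B \<noteq> {}" using P0 by blast
    show "l P > 0" for P using l_exp(1)[of P] R by linarith
  next
    fix P assume P: "P \<in> B" and "\<And>P'. P' \<in> B \<Longrightarrow> l P' \<le> l P"
    then have "l P0 \<le> l P" using P0 by blast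
    \<comment> \<open>Comparison with the direction colouring \<open>P0\<close> leaves a deficit of
      at most \<open>16 * R < 1\<close> in the number of alternating squares, and that number is an
      integer.\<close>
    then have "\<epsilon> ^ 4 * real Q / 8 - R * \<epsilon> ^ 4 \<le> \<epsilon> ^ 4 * real (card (alternating_squares d P)) / 8 + R * \<epsilon> ^ 4"
      using l_exp(2)[of P] l_exp(2)[of P0] unfolding P0(2) by linarith
    then have "\<epsilon> ^ 4 * (real Q / 8 - R) \<le> \<epsilon> ^ 4 * (real (card (alternating_squares d P)) / 8 + R)"
      by (simp add: algebra_simps)
    then have "real Q / 8 - R \<le> real (card (alternating_squares d P)) / 8 + R" using \<epsilon> by simp
    then have max: "card (alternating_squares d P) \<ge> Q" using R by linarith
    have bal: "cube_balanced d (d + 1) P (cube_edges d)" using P by (simp add: B_def E_def)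
    define X where "X w = (\<Sum>(v, i, j)\<in>{(v, i, j)\<in>corners d. cube_balanced d 2 P (square d v i j)}.
      Re (\<Prod>e\<in>square d v i j. cj (e \<in> P) w))" for w
    have X: "X w = real (card (cube_verts d)) * (2 * (real h)\<^sup>2 * cmod w ^ 4 + 2 * real h * (real h - 1) * Re (w ^ 4))" for w
      unfolding X_def using sum_square_weights[OF bal d _ max[unfolded Q_def]] h by simp
    \<comment> \<open>Here \<open>cmod z ^ 4 = 1\<close>, while the fourth power of
      \<open>4 / 5\<close> is \<open>256 / 625\<close>. The bracket
      \<open>414 * real h - 783\<close> is at least 45 for \<open>h \<ge> 2\<close> but negative for
      \<open>h = 1\<close>, so this is where \<open>d > 2\<close> enters.\<close>
    have diff: "X (of_real (Re z)) - X z = real (card (cube_verts d)) * (2 * real h / 625 * (414 * real h - 783))"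
      unfolding X z by (simp add: power4_eq_xxxx power2_eq_square norm_divide field_simps)
    have "2 * real h / 625 * (414 * real h - 783) \<ge> 4 / 625 * 45"
      using h by (intro mult_mono) auto
    then have "X (of_real (Re z)) - X z \<ge> 1 * (4 / 625 * 45)"
      unfolding diff using V h by (intro mult_mono) auto
    then have "(X (of_real (Re z)) - X z) / 8 \<ge> 1 * (4 / 625 * 45) / 8"
      by (rule divide_right_mono) simp
    then have "(X (of_real (Re z)) - X z) / 8 > 2 * R" by (rule less_le_trans[rotated]) (simp add: R)
    then have "\<epsilon> ^ 4 * ((X (of_real (Re z)) - X z) / 8) > \<epsilon> ^ 4 * (2 * R)"
      using \<epsilon>(1) by (intro mult_strict_left_mono) auto
    then have "\<epsilon> ^ 4 * X (of_real (Re z)) / 8 - \<epsilon> ^ 4 * X z / 8 > 2 * (R * \<epsilon> ^ 4)"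
      by (simp add: algebra_simps diff_divide_distrib)
    moreover have "cmod (of_real (Re z)) \<le> 1" "cmod z \<le> 1" by (simp_all add: z)
    note p_exp(2)[OF this(1), of P] p_exp(2)[OF this(2), of P]
    ultimately show "p (of_real (Re z)) P - p z P > 0"
      unfolding X_def[symmetric] by linarith
  qed
  then obtain k where k: "(\<Sum>P\<in>B. l P ^ k * (p (of_real (Re z)) P - p z P)) > 0" by blast
  \<comment> \<open>Both factors are close to 1, so the sum at \<open>z\<close> is its own absolute
    value and the inequality for absolute values contradicts \<open>k\<close>.\<close>
  have "p z P \<ge> 0" "l P \<ge> 0" for P using p_exp(1)[of z P] l_exp(1)[of P] R z by linarith+
  then have "0 \<le> (\<Sum>P\<in>B. l P ^ k * p z P)" by (intro sum_nonneg mult_nonneg_nonneg) auto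
  moreover have "\<bar>\<Sum>P\<in>B. l P ^ k * p (of_real (Re z)) P\<bar> \<le> \<bar>\<Sum>P\<in>B. l P ^ k * p z P\<bar>"
    unfolding B_def l_def p_def E_def using d h by (intro norming_test_matrix_le[OF N]) simp
  ultimately show False using k by (simp add: right_diff_distrib sum_subtractf)
qed

theorem theorem1p5:
  fixes d :: nat
  assumes "d > 2"
  shows "\<not> norming (cube_even d) (cube_odd d) (cube_edges d)"
proof (cases "even d")
  case True
  then obtain h where "d = 2 * h" by (auto elim: evenE)
  moreover from this have "h \<ge> 2" using assms by simp
  ultimately show ?thesis by (rule not_norming_even_cube)
qed (rule not_norming_odd_cube)

end
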